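(* Let $\mathbf{w}\in\mathcal{V}$ be a generalized snake word of length $n$. There exists a bijection $\Gamma:\mathcal{G}(\mathbf{w})\to\mathcal{C}(Q_{\mathbf{w}})$ between the set $\mathcal{G}(\mathbf{w})$ of nonempty connected induced subgraphs of the graph $G(\mathbf{w})$ and the set $\mathcal{C}(Q_{\mathbf{w}})$ of circuits of the vertex set of the order polytope $\mathcal{O}(Q_{\mathbf{w}})$.
   Context: A generalized snake word of length $n\ge 0$ is a word $\mathbf{w}=w_0w_1\cdots w_n$ where $w_0=\varepsilon$ is the empty letter and $w_i\in\{L,R\}$ for $1\le i\le n$. $\mathcal{V}$ is the set of generalized snake words that do not contain $LRL$ or $RLR$ as a (contiguous) substring. The generalized snake poset $P(\mathbf{w})$ is defined recursively ($\prec$ denotes a cover relation). $P(\varepsilon)$ is the poset on $\{0,1,2,3\}$ with cover relations $1\prec 0$, $2\prec 0$, $3\prec 1$, $3\prec 2$. For $n\ge 1$, $P(w_0\cdots w_n)$ is $P(w_0\cdots w_{n-1})\cup\{2n+2,2n+3\}$ with the added cover relations $2n+3\prec 2n+1$, $2n+3\prec 2n+2$, and: $2n+2\prec 2n-1$ if ($n=1$ and $w_n=L$) or ($n\ge2$ and $w_{n-1}w_n\in\{RL,LR\}$); $2n+2\prec 2n$ if ($n=1$ and $w_n=R$) or ($n\ge 2$ and $w_{n-1}w_n\in\{LL,RR\}$). Let $\widehat{P}(\mathbf{w})$ be $P(\mathbf{w})$ with a new minimum $\widehat 0$ and a new maximum $\widehat 1$ adjoined; it is a distributive lattice. $Q_{\mathbf{w}}$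 is the poset of meet-irreducible elements of $\widehat P(\mathbf{w})$ (elements $\ne\widehat 1$ covered by exactly one element), with the induced order. For a finite poset $Q$, the order polytope is $\mathcal{O}(Q)=\{x\in[0,1]^Q: x_i\le x_j \text{ whenever } i<_Q j\}$; its vertices are the indicator vectors of the filters (upper order ideals) of $Q$. The graph $G(\mathbf{w})$ has vertex set $\{w_0,\dots,w_n\}$ (the $n+1$ letter positions, regarded as distinct vertices), edges $\{w_i,w_{i+1}\}$ for $0\le i\le n-1$, and additional edges $\{w_i,w_{i+2}\}$ for those $0\le i\le n-2$ with $w_{i+1}\ne w_{i+2}$. (For $\mathbf{w}\in\mathcal{V}$ and $i\ge1$ this last condition says $w_iw_{i+1}w_{i+2}\in\{LLR,RRL\}$.) A circuit of a finite point set is a minimal affinely dependent subset (affinely dependent, with every proper subset affinely independent). *)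

theory Defs
  imports
    "HOL-Analysis.Analysis"
    "HOL-Library.Sublist"
    "HOL-Library.Function_Algebras"
    "Graph_Theory.Graph_Theory"
begin

section \<open>Generalized snake words\<close>

datatype letter = L | R

text \<open>
  A generalized snake word \<open>w\<^sub>0 w\<^sub>1 \<dots> w\<^sub>n\<close> is represented by the list \<open>[w\<^sub>1, \<dots>, w\<^sub>n]\<close> of its
  proper letters; the empty letter \<open>w\<^sub>0\<close> is left implicit and \<open>n\<close> is the length of the list.
  Hence \<open>w\<^sub>i\<close> is \<open>letter_at w i\<close>, which is meaningful only for \<open>1 \<le> i \<le> n\<close>.
\<close>
type_synonym snake_word = "letter list"

definition letter_at :: "snake_word \<Rightarrow> nat \<Rightarrow> letter" where
  "letter_at w i = w ! (i - 1)"

definition snake_words_V :: "snake_word set" where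
  "snake_words_V = {w. \<not> sublist [L, R, L] w \<and> \<not> sublist [R, L, R] w}"

section \<open>Posets\<close>

text \<open>
  A poset is represented by its reflexive order relation \<open>r\<close>; its ground set is \<open>Field r\<close>.
\<close>

definition covered_by :: "'a rel \<Rightarrow> 'a \<Rightarrow> 'a \<Rightarrow> bool" where
  "covered_by r x y \<longleftrightarrow>
     (x, y) \<in> r \<and> x \<noteq> y \<and> \<not> (\<exists>z. (x, z) \<in> r \<and> (z, y) \<in> r \<and> z \<noteq> x \<and> z \<noteq> y)"

section \<open>Generalized snake posets\<close>

text \<open>
  \<open>snake_covers w n\<close> lists the pairs \<open>(x, y)\<close> with \<open>x \<prec> y\<close> in \<open>P(w\<^sub>0 \<dots> w\<^sub>n)\<close>, for a prefix of \<open>w\<close>.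
\<close>
fun snake_covers :: "snake_word \<Rightarrow> nat \<Rightarrow> nat rel" where
  "snake_covers w 0 = {(1, 0), (2, 0), (3, 1), (3, 2)}"
| "snake_covers w (Suc m) =
     (let n = Suc m in
        snake_covers w m
        \<union> {(2 * n + 3, 2 * n + 1), (2 * n + 3, 2 * n + 2)}
        \<union> (if (n = 1 \<and> letter_at w n = L) \<or>
               (n \<ge> 2 \<and> (letter_at w (n - 1), letter_at w n) \<in> {(R, L), (L, R)})
            then {(2 * n + 2, 2 * n - 1)} else {})
        \<union> (if (n = 1 \<and> letter_at w n = R) \<or>
               (n \<ge> 2 \<and> (letter_at w (n - 1), letter_at w n) \<in> {(L, L), (R, R)})
            then {(2 * n + 2, 2 * n)} else {}))"

definition snake_poset :: "snake_word \<Rightarrow> nat rel" where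
  "snake_poset w = Id_on {0..2 * length w + 3} \<union> (snake_covers w (length w))\<^sup>+"

datatype 'a bounded = Bot | Elem 'a | Top

definition adjoin_bounds :: "'a rel \<Rightarrow> 'a bounded rel" where
  "adjoin_bounds r =
     (let A = insert Bot (insert Top (Elem ` Field r)) in
        {Bot} \<times> A \<union> A \<times> {Top} \<union> {(Elem x, Elem y) | x y. (x, y) \<in> r})"

definition snake_lattice :: "snake_word \<Rightarrow> nat bounded rel" where
  "snake_lattice w = adjoin_bounds (snake_poset w)"

definition meet_irreducibles :: "'a bounded rel \<Rightarrow> 'a bounded set" where
  "meet_irreducibles r = {x \<in> Field r. x \<noteq> Top \<and> (\<exists>!y. covered_by r x y)}"

definition snake_Q :: "snake_word \<Rightarrow> nat bounded rel" where
  "snake_Q w = Restr (snake_lattice w) (meet_irreducibles (snake_lattice w))"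

section \<open>Order polytopes and circuits\<close>

instantiation "fun" :: (type, real_vector) real_vector
begin

definition scaleR_fun :: "real \<Rightarrow> ('a \<Rightarrow> 'b) \<Rightarrow> 'a \<Rightarrow> 'b" where
  "scaleR_fun c f = (\<lambda>x. c *\<^sub>R f x)"

instance
  by standard (auto simp: scaleR_fun_def fun_eq_iff scaleR_add_right scaleR_add_left)

end

text \<open>
  The space \<open>\<real>\<^sup>Q\<close> for \<open>Q = Field r\<close> is realised as the subspace of the functions \<open>'a \<Rightarrow> real\<close>
  that vanish outside \<open>Q\<close>.
\<close>
definition order_polytope :: "'a rel \<Rightarrow> ('a \<Rightarrow> real) set" where
  "order_polytope r =
     {x. (\<forall>i. i \<notin> Field r \<longrightarrow> x i = 0) \<and> (\<forall>i \<in> Field r. x i \<in> {0..1}) \<and>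
         (\<forall>(i, j) \<in> r. x i \<le> x j)}"

definition polytope_vertices :: "'a::real_vector set \<Rightarrow> 'a set" where
  "polytope_vertices S = {v. v extreme_point_of S}"

definition circuits :: "'a::real_vector set \<Rightarrow> 'a set set" where
  "circuits V = {C. C \<subseteq> V \<and> affine_dependent C \<and> (\<forall>D. D \<subset> C \<longrightarrow> \<not> affine_dependent D)}"

definition order_circuits :: "'a rel \<Rightarrow> ('a \<Rightarrow> real) set set" where
  "order_circuits r = circuits (polytope_vertices (order_polytope r))"

section \<open>The graph of a snake word\<close>

definition word_edges :: "snake_word \<Rightarrow> nat rel" where
  "word_edges w =
     {(i, i + 1) | i. i + 1 \<le> length w} \<union>
     {(i, i + 2) | i. i + 2 \<le> length w \<and> letter_at w (i + 1) \<noteq> letter_at w (i + 2)}"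

text \<open>
  The vertex \<open>w\<^sub>i\<close> is represented by the position \<open>i\<close>.  An undirected edge is, as usual for
  \<open>Graph_Theory\<close>, a pair of opposite arcs.
\<close>
definition word_graph :: "snake_word \<Rightarrow> (nat, nat \<times> nat) pre_digraph" where
  "word_graph w =
     with_proj \<lparr>pverts = {0..length w}, parcs = word_edges w \<union> (word_edges w)\<inverse>\<rparr>"

text \<open>
  The qualified name avoids the topological \<open>connected\<close>.
\<close>
definition connected_induced_subgraphs ::
    "('a, 'b) pre_digraph \<Rightarrow> ('a, 'b) pre_digraph set" where
  "connected_induced_subgraphs G =
     {H. induced_subgraph H G \<and> verts H \<noteq> {} \<and> Digraph_Component.connected H}"

end

theory Submission
  imports Defs
begin

text \<open>
  By Birkhoff's theorem the vertices of the order polytope correspond to the elements of the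
  lattice, and each of its \<open>n + 1\<close> squares gives the affine relation
  \<open>top + bottom = side + side\<close>.  These relations form a basis of all affine relations, so circuits
  are the minimal supports of the vectors \<open>\<Sum>i\<le>n. c i * square i\<close>.  The coordinates of such a vector
  are, up to sign, \<open>c 0\<close>, \<open>c n\<close>, the differences \<open>c i - c (i + 1)\<close>, and, for every change of letter
  \<open>w\<^sub>j \<noteq> w\<^sub>j\<^sub>+\<^sub>1\<close>, the two forms \<open>c j\<close> and \<open>c (j - 1) - c j + c (j + 1)\<close>; avoiding \<open>LRL\<close> and
  \<open>RLR\<close> is what makes all the differences occur.  The minimal supports are
  realised exactly by the \<open>c\<close> supported on a connected vertex set \<open>S\<close> with values \<open>\<plusminus>1\<close> that change
  sign at every position skipped by \<open>S\<close>.
\<close>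

section \<open>Circuits as minimal supports of affine relations\<close>

text \<open>The forms at a change of letter come from the element \<open>2 j + 1\<close>, where
  three squares meet: it is the bottom of square \<open>j - 1\<close>, a side of square
  \<open>j\<close> and the top of square \<open>j + 1\<close>. The other side \<open>2 j + 2\<close>
  of square \<open>j\<close> then lies in no other square, so its coordinate is only
  \<open>- c j\<close>, and the difference of \<open>c j\<close> and \<open>c (j + 1)\<close> has to
  be read off at \<open>2 j + 3\<close>. A change of letter at \<open>j + 1\<close> as well would
  make three squares meet at \<open>2 j + 3\<close> too, and the difference would be lost. That the
  squares span all relations agrees with a count: there are \<open>2 n + 6\<close> lattice elements
  and \<open>n + 4\<close> meet-irreducible ones, and together with the vanishing coefficient sum
  this leaves \<open>n + 1\<close> relations. The proof replaces the count by elimination at the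
  bottoms \<open>2 i + 3\<close>. Minimality is never tested against other circuits. Two comparisons
  suffice: a relation supported inside that of a connected set is a multiple of it, and every
  nonzero relation has one of a connected set inside its support.\<close>

definition affine_relation :: "'i set \<Rightarrow> ('i \<Rightarrow> 'v::real_vector) \<Rightarrow> ('i \<Rightarrow> real) \<Rightarrow> bool" where
  "affine_relation I p l \<longleftrightarrow> sum l I = 0 \<and> (\<Sum>x\<in>I. l x *\<^sub>R p x) = 0"

text \<open>Coefficients are kept on the whole index set and required to vanish off
  \<open>J\<close>, so that relations with different supports lie in one space and can be compared.
  The two directions extend by zero and transport along the inverse of \<open>p\<close>.\<close>

lemma affine_dependent_image_iff:
  assumes I: "finite I" "inj_on p I" and J: "J \<subseteq> I"
  shows "affine_dependent (p ` J) \<longleftrightarrow>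
    (\<exists>l. affine_relation I p l \<and> (\<exists>x\<in>I. l x \<noteq> 0) \<and> (\<forall>x\<in>I - J. l x = 0))"
    (is "?dep \<longleftrightarrow> ?rel")
proof -
  have inj: "inj_on p J" and finJ: "finite J" using I J inj_on_subset finite_subset by blast+
  have dep: "?dep \<longleftrightarrow> (\<exists>U. sum U (p ` J) = 0 \<and> (\<exists>v\<in>p ` J. U v \<noteq> 0) \<and> (\<Sum>v\<in>p ` J. U v *\<^sub>R v) = 0)"
    using finJ by (intro affine_dependent_explicit_finite) auto
  show ?thesis
  proof
    assume ?dep
    then obtain U where U: "sum U (p ` J) = 0" "\<exists>v\<in>p ` J. U v \<noteq> 0" "(\<Sum>v\<in>p ` J. U v *\<^sub>R v) = 0"
      unfolding dep by blast
    let ?l = "\<lambda>x. if x \<in> J then U (p x) else 0"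
    have "sum ?l I = sum ?l J" "(\<Sum>x\<in>I. ?l x *\<^sub>R p x) = (\<Sum>x\<in>J. ?l x *\<^sub>R p x)"
      by (intro sum.mono_neutral_right; use I J in auto)+
    then have "affine_relation I p ?l"
      using U(1,3) inj by (simp add: affine_relation_def sum.reindex)
    then show ?rel using U(2) J by (intro exI[of _ ?l]) auto
  next
    assume ?rel
    then obtain l where l: "affine_relation I p l" "\<exists>x\<in>I. l x \<noteq> 0" "\<forall>x\<in>I - J. l x = 0"
      by blast
    have "sum l I = sum l J" "(\<Sum>x\<in>I. l x *\<^sub>R p x) = (\<Sum>x\<in>J. l x *\<^sub>R p x)"
      by (intro sum.mono_neutral_right; use I J l in auto)+
    then show ?dep unfolding dep using l inj
      by (intro exI[of _ "\<lambda>v. l (inv_into J p v)"]) (auto simp: affine_relation_def sum.reindex)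
  qed
qed

text \<open>\<open>below\<close> puts the support of some \<open>vec s\<close> inside every
  dependent set. \<open>multiple\<close> makes these supports minimal: a relation on a proper subset
  would be a nonzero multiple of \<open>vec s\<close> and so have full support. Equal supports make
  \<open>vec s\<close> a multiple of \<open>vec t\<close>, and \<open>inj\<close> then identifies
  \<open>s\<close> and \<open>t\<close>.\<close>

lemma bij_betw_circuits:
  fixes p :: "'i \<Rightarrow> 'v::real_vector" and vec :: "'s \<Rightarrow> 'i \<Rightarrow> real"
  assumes I: "finite I" "inj_on p I"
    and rel: "\<And>s. s \<in> A \<Longrightarrow> affine_relation I p (vec s)"
    and nonzero: "\<And>s. s \<in> A \<Longrightarrow> \<exists>x\<in>I. vec s x \<noteq> 0"
    and multiple: "\<And>s l. s \<in> A \<Longrightarrow> affine_relation I p l \<Longrightarrow> (\<forall>x\<in>I. vec s x = 0 \<longrightarrow> l x = 0) \<Longrightarrow>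
      \<exists>a. \<forall>x\<in>I. l x = a * vec s x"
    and below: "\<And>l. affine_relation I p l \<Longrightarrow> \<exists>x\<in>I. l x \<noteq> 0 \<Longrightarrow>
      \<exists>s\<in>A. \<forall>x\<in>I. l x = 0 \<longrightarrow> vec s x = 0"
    and inj: "\<And>s t a. s \<in> A \<Longrightarrow> t \<in> A \<Longrightarrow> \<forall>x\<in>I. vec s x = a * vec t x \<Longrightarrow> s = t"
  shows "bij_betw (\<lambda>s. p ` {x\<in>I. vec s x \<noteq> 0}) A (circuits (p ` I))"
proof -
  let ?supp = "\<lambda>s. {x\<in>I. vec s x \<noteq> 0}"
  have dep: "affine_dependent (p ` ?supp s)" if "s \<in> A" for s
    using rel[OF that] nonzero[OF that] by (subst affine_dependent_image_iff[OF I]) auto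
  have indep: "\<not> affine_dependent (p ` J)" if s: "s \<in> A" and J: "J \<subset> ?supp s" for s J
  proof
    assume "affine_dependent (p ` J)"
    moreover have "J \<subseteq> I" using J by auto
    ultimately obtain l where l: "affine_relation I p l" "\<exists>x\<in>I. l x \<noteq> 0" "\<forall>x\<in>I - J. l x = 0"
      using affine_dependent_image_iff[OF I] by blast
    then obtain a where a: "\<forall>x\<in>I. l x = a * vec s x"
      using multiple[OF s l(1)] J by blast
    then have "a \<noteq> 0" using l(2) by auto
    then show False using a l(3) J by auto
  qed
  have "inj_on (\<lambda>s. p ` ?supp s) A"
  proof (rule inj_onI)
    fix s t assume st: "s \<in> A" "t \<in> A" "p ` ?supp s = p ` ?supp t"
    have "?supp s = ?supp t"
      using inj_on_image_eq_iff[OF I(2)] st(3) by (metis (no_types, lifting) mem_Collect_eq subsetI)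
    then have "\<forall>x\<in>I. vec t x = 0 \<longrightarrow> vec s x = 0" by blast
    then show "s = t" using multiple[OF st(2) rel[OF st(1)]] inj st by blast
  qed
  moreover have "p ` ?supp s \<in> circuits (p ` I)" if s: "s \<in> A" for s
    unfolding circuits_def
  proof (intro CollectI conjI allI impI)
    fix D assume D: "D \<subset> p ` ?supp s"
    define J where "J = {x\<in>?supp s. p x \<in> D}"
    have "D = p ` J" using D by (auto simp: J_def)
    moreover have "J \<subset> ?supp s" using D by (auto simp: J_def)
    ultimately show "\<not> affine_dependent D" using indep s by blast
  qed (use dep s in auto)
  moreover have "C \<in> (\<lambda>s. p ` ?supp s) ` A" if "C \<in> circuits (p ` I)" for C
  proof -
    have C: "C \<subseteq> p ` I" "affine_dependent C" "\<And>D. D \<subset> C \<Longrightarrow> \<not> affine_dependent D"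
      using that by (auto simp: circuits_def)
    then obtain J where J: "J \<subseteq> I" "C = p ` J" by (meson subset_imageE)
    then obtain l where l: "affine_relation I p l" "\<exists>x\<in>I. l x \<noteq> 0" "\<forall>x\<in>I - J. l x = 0"
      using C(2) affine_dependent_image_iff[OF I] by blast
    then obtain s where s: "s \<in> A" "\<forall>x\<in>I. l x = 0 \<longrightarrow> vec s x = 0" using below by blast
    then have "p ` ?supp s \<subseteq> C" using l(3) J by auto
    then have "p ` ?supp s = C" using C(3)[of "p ` ?supp s"] dep[OF s(1)] by blast
    then show ?thesis using s(1) by blast
  qed
  ultimately show ?thesis by (auto simp: bij_betw_def)
qed

section \<open>Vertices of order polytopes\<close>

text \<open>
  A point of the order polytope is the midpoint of its images under the monotone maps
  \<open>t \<mapsto> t\<^sup>2\<close> and \<open>t \<mapsto> 2 t - t\<^sup>2\<close>, which differ at every \<open>0 < t < 1\<close>.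
\<close>
lemma polytope_vertices_order_polytope:
  "polytope_vertices (order_polytope r) =
     {x. (\<forall>i. i \<notin> Field r \<longrightarrow> x i = 0) \<and> (\<forall>i. x i \<in> {0, 1}) \<and> (\<forall>(i, j) \<in> r. x i \<le> x j)}"
    (is "_ = ?Z")
proof (intro equalityI subsetI)
  fix x assume "x \<in> polytope_vertices (order_polytope r)"
  then have ext: "x extreme_point_of order_polytope r" by (simp add: polytope_vertices_def)
  then have x: "\<And>i. i \<notin> Field r \<Longrightarrow> x i = 0" "\<And>i. i \<in> Field r \<Longrightarrow> 0 \<le> x i \<and> x i \<le> 1"
    "\<And>i j. (i, j) \<in> r \<Longrightarrow> x i \<le> x j"
    by (auto simp: extreme_point_of_def order_polytope_def)
  define f g where "f = (\<lambda>i. (x i)\<^sup>2)" and "g = (\<lambda>i. 1 - (1 - x i)\<^sup>2)"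
  have fr: "i \<in> Field r \<and> j \<in> Field r" if "(i, j) \<in> r" for i j
    using that by (auto simp: Field_def)
  have "f \<in> order_polytope r" "g \<in> order_polytope r"
    using x fr by (fastforce simp: order_polytope_def f_def g_def power_le_one intro!: power_mono)+
  then have "x \<notin> open_segment f g" using ext by (auto simp: extreme_point_of_def)
  moreover have "x = (1 - 1/2) *\<^sub>R f + (1/2 :: real) *\<^sub>R g"
    by (auto simp: f_def g_def fun_eq_iff scaleR_fun_def power2_eq_square field_simps)
  ultimately have "f = g" unfolding in_segment by (metis half_gt_zero_iff less_numeral_extra(1) field_sum_of_halves less_add_same_cancel1)
  then have "x i \<in> {0, 1}" for i
    by (auto simp: f_def g_def fun_eq_iff power2_eq_square algebra_simps dest!: spec[of _ i])
  then show "x \<in> ?Z" using x by auto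
next
  fix x assume x: "x \<in> ?Z"
  show "x \<in> polytope_vertices (order_polytope r)"
    unfolding polytope_vertices_def extreme_point_of_def
  proof (intro CollectI conjI ballI notI)
    show "x \<in> order_polytope r"
    proof -
      have "0 \<le> x i" "x i \<le> 1" for i
        using x by (auto dest!: spec[of "\<lambda>i. x i = 0 \<or> x i = 1" i])
      then show ?thesis using x by (auto simp: order_polytope_def)
    qed
    fix a b assume ab: "a \<in> order_polytope r" "b \<in> order_polytope r" "x \<in> open_segment a b"
    then obtain u where u: "a \<noteq> b" "0 < u" "u < 1" "x = (1 - u) *\<^sub>R a + u *\<^sub>R b"
      by (auto simp: in_segment)
    \<comment> \<open>In each coordinate an endpoint of the unit interval is a proper convex
      combination of points of the interval only if both are that endpoint.\<close>
    have "a i = b i" for i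
    proof (cases "i \<in> Field r")
      case True
      have xi: "x i = (1 - u) * a i + u * b i" using u(4) by (simp add: scaleR_fun_def)
      have bd: "0 \<le> a i" "a i \<le> 1" "0 \<le> b i" "b i \<le> 1" using ab True by (auto simp: order_polytope_def)
      consider "x i = 0" | "x i = 1" using x by blast
      then show ?thesis
      proof cases
        case 1
        moreover have "0 \<le> (1 - u) * a i" "0 \<le> u * b i" using u bd by auto
        ultimately have "(1 - u) * a i = 0" "u * b i = 0" using xi by linarith+
        then show ?thesis using u by auto
      next
        case 2
        moreover have "0 \<le> (1 - u) * (1 - a i)" "0 \<le> u * (1 - b i)" using u bd by auto
        moreover have "(1 - u) * (1 - a i) + u * (1 - b i) = 1 - x i"
          unfolding xi by (simp add: algebra_simps)
        ultimately have "(1 - u) * (1 - a i) = 0" "u * (1 - b i) = 0" by linarith+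
        then show ?thesis using u by auto
      qed
    qed (use ab in \<open>auto simp: order_polytope_def\<close>)
    then show False using u(1) by auto
  qed
qed

section \<open>Connected vertex sets and sign vectors\<close>

text \<open>With the list index shifted by one this is the change
  \<open>w\<^sub>j \<noteq> w\<^sub>j\<^sub>+\<^sub>1\<close>. The additional edges of the word
  graph are the ones that jump over such a position \<open>j\<close>.\<close>

definition kink :: "snake_word \<Rightarrow> nat \<Rightarrow> bool" where
  "kink w j \<longleftrightarrow> 1 \<le> j \<and> j < length w \<and> w ! (j - 1) \<noteq> w ! j"

lemma kink_imp_less: "kink w j \<Longrightarrow> j < length w" and kink_imp_pos: "kink w j \<Longrightarrow> 0 < j"
  by (auto simp: kink_def)

text \<open>Two adjacent changes make the letters at positions \<open>j\<close>,
  \<open>j + 1\<close>, \<open>j + 2\<close> alternate. The hypothesis on the word enters the whole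
  development only through this fact.\<close>

lemma not_kink_Suc:
  assumes "w \<in> snake_words_V" "kink w j"
  shows "\<not> kink w (Suc j)"
proof
  assume "kink w (Suc j)"
  with assms(2) have j: "1 \<le> j" "Suc j < length w" "w ! (j - 1) \<noteq> w ! j" "w ! j \<noteq> w ! Suc j"
    by (auto simp: kink_def)
  obtain i where i: "j = Suc i" using j(1) by (cases j) auto
  have "w = take i w @ [w ! i, w ! Suc i, w ! Suc (Suc i)] @ drop (Suc (Suc (Suc i))) w"
    using j(2) i by (simp add: Cons_nth_drop_Suc)
  then have "sublist [w ! i, w ! Suc i, w ! Suc (Suc i)] w"
    unfolding sublist_def by blast
  moreover have "[w ! i, w ! Suc i, w ! Suc (Suc i)] \<in> {[L, R, L], [R, L, R]}"
    using j(3,4) i by (cases "w ! i"; cases "w ! Suc i"; cases "w ! Suc (Suc i)") auto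
  ultimately show False using assms(1) by (auto simp: snake_words_V_def)
qed

text \<open>The word graph is a path with additional edges over the kinks, so connectivity becomes a
  condition on the missing positions between two members: each must be an isolated gap bridged by an
  additional edge. The equivalence is \<open>connected_induce_iff\<close>.\<close>

definition gap_connected :: "snake_word \<Rightarrow> nat set \<Rightarrow> bool" where
  "gap_connected w S \<longleftrightarrow>
     (\<forall>a\<in>S. \<forall>b\<in>S. \<forall>i. a < i \<and> i < b \<and> i \<notin> S \<longrightarrow> i - 1 \<in> S \<and> i + 1 \<in> S \<and> kink w i)"

definition connected_sets :: "snake_word \<Rightarrow> nat set set" where
  "connected_sets w = {S. S \<noteq> {} \<and> S \<subseteq> {..length w} \<and> gap_connected w S}"

text \<open>For a kink \<open>j\<close> this is the coordinate at the element
  \<open>2 j + 1\<close>, which is the bottom of square \<open>j - 1\<close>, a side of square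
  \<open>j\<close> and the top of square \<open>j + 1\<close>.\<close>

definition kink_form :: "(nat \<Rightarrow> real) \<Rightarrow> nat \<Rightarrow> real" where
  "kink_form c j = c (j - 1) - c j + c (j + 1)"

text \<open>
  The forms below are, up to sign, the coordinates of the combination of squares with
  coefficients \<open>c\<close>, so this compares supports of affine relations (\<open>square_comb_vanish_iff\<close>).
\<close>
definition forms_vanish_mono :: "snake_word \<Rightarrow> (nat \<Rightarrow> real) \<Rightarrow> (nat \<Rightarrow> real) \<Rightarrow> bool" where
  "forms_vanish_mono w c c' \<longleftrightarrow>
     (c 0 = 0 \<longrightarrow> c' 0 = 0) \<and> (c (length w) = 0 \<longrightarrow> c' (length w) = 0) \<and>
     (\<forall>i<length w. c i = c (i + 1) \<longrightarrow> c' i = c' (i + 1)) \<and>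
     (\<forall>j. kink w j \<longrightarrow> (c j = 0 \<longrightarrow> c' j = 0) \<and> (kink_form c j = 0 \<longrightarrow> kink_form c' j = 0))"

text \<open>The exponent also counts the positions before the first member of \<open>S\<close>. They
  contribute one common sign, which is harmless because relations matter only up to a
  scalar.\<close>

definition alt_vec :: "nat set \<Rightarrow> nat \<Rightarrow> real" where
  "alt_vec S i = (if i \<in> S then (-1) ^ card ({..<i} - S) else 0)"

lemma alt_vec_eq_0_iff [simp]: "alt_vec S i = 0 \<longleftrightarrow> i \<notin> S"
  by (simp add: alt_vec_def)

lemma alt_sign_Suc:
  "(-1 :: real) ^ card ({..<Suc i} - S) = (if i \<in> S then 1 else -1) * (-1) ^ card ({..<i} - S)"
proof (cases "i \<in> S")
  case False
  then have "{..<Suc i} - S = insert i ({..<i} - S)" by auto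
  then show ?thesis using False by (simp add: lessThan_Suc)
next
  case True
  then have "{..<Suc i} - S = {..<i} - S" by (auto simp: less_Suc_eq)
  then show ?thesis using True by simp
qed

lemma alt_vec_eq_Suc_iff: "alt_vec S i = alt_vec S (Suc i) \<longleftrightarrow> (i \<in> S \<longleftrightarrow> Suc i \<in> S)"
  by (auto simp: alt_vec_def alt_sign_Suc)

text \<open>The right-hand side says that an even number of \<open>j - 1\<close>, \<open>j\<close>,
  \<open>j + 1\<close> belong to \<open>S\<close>. Adjacent members carry the same sign and members
  on both sides of a single gap opposite signs, so the terms of two members cancel, while one or
  three leave a value \<plusminus>1.\<close>

lemma kink_form_alt_vec_eq_0_iff:
  assumes "0 < j"
  shows "kink_form (alt_vec S) j = 0 \<longleftrightarrow> ((j - 1 \<in> S) = ((j \<in> S) = (j + 1 \<notin> S)))"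
proof -
  obtain i where "j = Suc i" using assms by (cases j) auto
  then show ?thesis by (auto simp: kink_form_def alt_vec_def alt_sign_Suc)
qed

text \<open>The vanishing forms of \<open>alt_vec S\<close> are equations for \<open>c\<close> that
  leave one free scalar: they force \<open>c\<close> to be zero off \<open>S\<close> and tie its
  values at consecutive members of \<open>S\<close> together up to sign.\<close>

lemma multiple_of_alt_vec:
  assumes S: "S \<in> connected_sets w" and mono: "forms_vanish_mono w (alt_vec S) c"
  obtains a where "\<And>i. i \<le> length w \<Longrightarrow> c i = a * alt_vec S i"
proof -
  let ?n = "length w"
  have fin: "finite S" and ne: "S \<noteq> {}" and sub: "S \<subseteq> {..?n}" and gc: "gap_connected w S"
    using S finite_subset by (auto simp: connected_sets_def)
  have same: "c i = c (Suc i)" if "i < ?n" "i \<in> S \<longleftrightarrow> Suc i \<in> S" for i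
    using mono that by (auto simp: forms_vanish_mono_def alt_vec_eq_Suc_iff)
  \<comment> \<open>Zero spreads inwards from the end \<open>0\<close> through equal neighbours, and
    in \<open>high\<close> likewise from the end \<open>length w\<close>.\<close>
  have low: "i < Min S \<Longrightarrow> c i = 0" for i
  proof (induction i)
    case 0
    then have "0 \<notin> S" using fin ne by auto
    then show ?case using mono by (auto simp: forms_vanish_mono_def)
  next
    case (Suc i)
    have "i \<notin> S" "Suc i \<notin> S" using Suc.prems fin ne by auto
    moreover have "Suc i \<le> ?n" using Suc.prems fin ne sub Min_in[OF fin ne] by force
    ultimately show ?case using Suc same[of i] by auto
  qed
  have high: "i \<le> ?n \<Longrightarrow> Max S < i \<Longrightarrow> c i = 0" for i
  proof (induction i rule: inc_induct)
    case base
    then have "?n \<notin> S" using fin by (metis Max_ge not_le)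
    then show ?case using mono by (auto simp: forms_vanish_mono_def)
  next
    case (step i)
    have "i \<notin> S" "Suc i \<notin> S" using step.prems fin by (metis Max_ge not_le less_SucI)+
    then show ?case using step \<open>i < ?n\<close> same[of i] by auto
  qed
  have gap: "i - 1 \<in> S" "i + 1 \<in> S" "kink w i" if "i \<notin> S" "Min S < i" "i < Max S" for i
    using gc that Min_in[OF fin ne] Max_in[OF fin ne] by (auto simp: gap_connected_def)
  have zero: "c i = 0" if "i \<le> ?n" "i \<notin> S" for i
  proof -
    have "i \<noteq> Min S" "i \<noteq> Max S" using that(2) Min_in[OF fin ne] Max_in[OF fin ne] by auto
    then consider "i < Min S" | "Max S < i" | "Min S < i" "i < Max S"
      by (meson linorder_neqE_nat)
    then show ?thesis
    proof cases
      case 3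
      with gap[of i] that mono show ?thesis by (auto simp: forms_vanish_mono_def)
    qed (use low high that in auto)
  qed
  \<comment> \<open>The sign of \<open>alt_vec S\<close> is divided out, so proportionality on
    \<open>S\<close> becomes constancy of \<open>e\<close>. The induction steps back to the
    preceding member of \<open>S\<close>, which is one or two positions away.\<close>
  define e where "e i = (-1) ^ card ({..<i} - S) * c i" for i
  have e: "e i = e (Min S)" if "i \<in> S" for i
    using that
  proof (induction i rule: less_induct)
    case (less i)
    show ?case
    proof (cases "i = Min S")
      case False
      then have i: "Min S < i" using less.prems fin by (metis Min_le le_neq_implies_less)
      then obtain k where k: "i = Suc k" by (cases i) auto
      have n: "k < ?n" using less.prems sub k by auto
      show ?thesis
      proof (cases "k \<in> S")
        case True
        then have "e i = e k" using same[of k] less.prems k n by (auto simp: e_def alt_sign_Suc)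
        then show ?thesis using less.IH[of k] True k by auto
      next
        case False
        have "k < Max S" using less.prems k fin by (metis Max_ge Suc_le_lessD)
        moreover have "Min S < k" using i k False fin ne by (metis Min_in less_antisym)
        ultimately have g: "k - 1 \<in> S" "kink w k" using gap False by auto
        then obtain j where j: "k = Suc j" by (cases k) (auto simp: kink_def)
        have "kink_form (alt_vec S) k = 0"
          using g less.prems k j False by (subst kink_form_alt_vec_eq_0_iff) auto
        then have "kink_form c k = 0" using mono g by (auto simp: forms_vanish_mono_def)
        moreover have "c k = 0" using zero False n by auto
        ultimately have "c i = - c j" using k j by (auto simp: kink_form_def)
        then have "e i = e j" using g j k False by (auto simp: e_def alt_sign_Suc)
        then show ?thesis using less.IH[of j] g j k by auto
      qed
    qed simp
  qed
  have "c i = e (Min S) * alt_vec S i" if "i \<le> ?n" for i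
  proof (cases "i \<in> S")
    case True
    have "c i = e i * alt_vec S i" using True by (simp add: alt_vec_def e_def ac_simps)
    then show ?thesis using e True by simp
  qed (use zero that in simp)
  then show ?thesis using that by blast
qed

text \<open>
  Starting at \<open>i\<close>, move right as long as \<open>c\<close> is constant; where it changes, jump over a kink
  whose form vanishes, and otherwise stop.
\<close>
lemma greedy_connected_set:
  assumes w: "w \<in> snake_words_V" and "i \<le> length w" "c i \<noteq> 0"
  shows "\<exists>T. i \<in> T \<and> T \<subseteq> {i..length w} \<and>
    (\<forall>b\<in>T. \<forall>j. i < j \<and> j < b \<and> j \<notin> T \<longrightarrow> j - 1 \<in> T \<and> j + 1 \<in> T \<and> kink w j) \<and>
    (\<forall>j\<in>T. c j \<noteq> 0) \<and>
    (\<forall>j\<ge>i. j < length w \<longrightarrow> (j \<in> T) \<noteq> (j + 1 \<in> T) \<longrightarrow> c j \<noteq> c (j + 1)) \<and>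
    (\<forall>j. j \<in> T \<and> j + 1 \<in> T \<longrightarrow> c j = c (j + 1)) \<and>
    (\<forall>j>i. kink w j \<longrightarrow> kink_form (alt_vec T) j \<noteq> 0 \<longrightarrow> kink_form c j \<noteq> 0)"
  using assms(2,3)
proof (induction "length w - i" arbitrary: i rule: less_induct)
  case less
  let ?n = "length w"
  show ?case
  proof (cases "i < ?n \<and> (c i = c (i + 1) \<or> kink w (i + 1) \<and> kink_form c (i + 1) = 0)")
    case False
    show ?thesis
    proof (intro exI[of _ "{i}"] conjI)
      show "\<forall>j>i. kink w j \<longrightarrow> kink_form (alt_vec {i}) j \<noteq> 0 \<longrightarrow> kink_form c j \<noteq> 0"
      proof (intro allI impI)
        fix j assume j: "i < j" "kink w j" "kink_form (alt_vec {i}) j \<noteq> 0"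
        \<comment> \<open>For \<open>j > i\<close> the positions \<open>j - 1\<close>,
          \<open>j\<close>, \<open>j + 1\<close> include \<open>i\<close> only when
          \<open>j - 1 = i\<close>.\<close>
        then have "j = i + 1" by (subst (asm) kink_form_alt_vec_eq_0_iff) auto
        then show "kink_form c j \<noteq> 0" using False j kink_imp_less[of w j] by auto
      qed
    qed (use less.prems False in auto)
  next
    case True
    show ?thesis
    proof (cases "c i = c (i + 1)")
      case eq: True
      have "?n - (i + 1) < ?n - i" "i + 1 \<le> ?n" "c (i + 1) \<noteq> 0" using True eq less.prems by auto
      from less.hyps[OF this] obtain T where T: "i + 1 \<in> T" "T \<subseteq> {i + 1..?n}"
        "\<forall>b\<in>T. \<forall>j. i + 1 < j \<and> j < b \<and> j \<notin> T \<longrightarrow> j - 1 \<in> T \<and> j + 1 \<in> T \<and> kink w j"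
        "\<forall>j\<in>T. c j \<noteq> 0"
        "\<forall>j\<ge>i + 1. j < ?n \<longrightarrow> (j \<in> T) \<noteq> (j + 1 \<in> T) \<longrightarrow> c j \<noteq> c (j + 1)"
        "\<forall>j. j \<in> T \<and> j + 1 \<in> T \<longrightarrow> c j = c (j + 1)"
        "\<forall>j>i + 1. kink w j \<longrightarrow> kink_form (alt_vec T) j \<noteq> 0 \<longrightarrow> kink_form c j \<noteq> 0"
        by blast
      show ?thesis
      proof (intro exI[of _ "insert i T"] conjI)
        show "\<forall>b\<in>insert i T. \<forall>j. i < j \<and> j < b \<and> j \<notin> insert i T \<longrightarrow>
            j - 1 \<in> insert i T \<and> j + 1 \<in> insert i T \<and> kink w j"
        proof (intro ballI allI impI)
          fix b j assume b: "b \<in> insert i T" and j: "i < j \<and> j < b \<and> j \<notin> insert i T"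
          then have "b \<in> T" "i + 1 < j" using T(1) by (auto intro: le_neq_implies_less)
          then show "j - 1 \<in> insert i T \<and> j + 1 \<in> insert i T \<and> kink w j"
            using T(3) j by blast
        qed
        show "\<forall>j>i. kink w j \<longrightarrow> kink_form (alt_vec (insert i T)) j \<noteq> 0 \<longrightarrow> kink_form c j \<noteq> 0"
        proof (intro allI impI)
          fix j assume j: "i < j" "kink w j" "kink_form (alt_vec (insert i T)) j \<noteq> 0"
          show "kink_form c j \<noteq> 0"
          proof (cases "j = i + 1")
            case True
            \<comment> \<open>An odd number of \<open>i\<close>, \<open>i + 1\<close>,
              \<open>i + 2\<close> are members and the first two are, so all three are. Then
              \<open>c\<close> is constant there and the form equals \<open>c i\<close>, which is
              nonzero.\<close>
            have "i + 2 \<in> T"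
              using j(3) T(1) unfolding True by (subst (asm) kink_form_alt_vec_eq_0_iff) auto
            then have "c (i + 1) = c (i + 2)" using T(1,6) by auto
            then show ?thesis using True eq less.prems by (simp add: kink_form_def)
          next
            case False
            then have "kink_form (alt_vec T) j \<noteq> 0"
              using j by (subst kink_form_alt_vec_eq_0_iff, simp,
                          subst (asm) kink_form_alt_vec_eq_0_iff) auto
            then show ?thesis using T(7) False j by auto
          qed
        qed
        show "\<forall>j\<ge>i. j < ?n \<longrightarrow> (j \<in> insert i T) \<noteq> (j + 1 \<in> insert i T) \<longrightarrow> c j \<noteq> c (j + 1)"
        proof (intro allI impI)
          fix j assume "i \<le> j" "j < ?n" "(j \<in> insert i T) \<noteq> (j + 1 \<in> insert i T)"
          then show "c j \<noteq> c (j + 1)" using T(1,5) by (cases "j = i") auto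
        qed
        show "\<forall>j. j \<in> insert i T \<and> j + 1 \<in> insert i T \<longrightarrow> c j = c (j + 1)"
          using T(2,6) eq by fastforce
      qed (use T(2,4) less.prems in auto)
    next
      case neq: False
      with True have k: "kink w (i + 1)" "kink_form c (i + 1) = 0" by auto
      have n: "i + 2 \<le> ?n" using k(1) kink_imp_less by fastforce
      \<comment> \<open>This equation justifies both ends of the jump: with \<open>neq\<close> it
        gives \<open>c (i + 2) \<noteq> 0\<close>, so the induction applies there, and with
        \<open>c i \<noteq> 0\<close> it gives \<open>c (i + 1) \<noteq> c (i + 2)\<close>.\<close>
      have c: "c (i + 1) = c i + c (i + 2)" using k(2) by (simp add: kink_form_def)
      have "?n - (i + 2) < ?n - i" "i + 2 \<le> ?n" "c (i + 2) \<noteq> 0" using n neq c by auto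
      from less.hyps[OF this] obtain T where T: "i + 2 \<in> T" "T \<subseteq> {i + 2..?n}"
        "\<forall>b\<in>T. \<forall>j. i + 2 < j \<and> j < b \<and> j \<notin> T \<longrightarrow> j - 1 \<in> T \<and> j + 1 \<in> T \<and> kink w j"
        "\<forall>j\<in>T. c j \<noteq> 0"
        "\<forall>j\<ge>i + 2. j < ?n \<longrightarrow> (j \<in> T) \<noteq> (j + 1 \<in> T) \<longrightarrow> c j \<noteq> c (j + 1)"
        "\<forall>j. j \<in> T \<and> j + 1 \<in> T \<longrightarrow> c j = c (j + 1)"
        "\<forall>j>i + 2. kink w j \<longrightarrow> kink_form (alt_vec T) j \<noteq> 0 \<longrightarrow> kink_form c j \<noteq> 0"
        by blast
      have i1: "i \<notin> T" "i + 1 \<notin> T" using T(2) by auto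
      show ?thesis
      proof (intro exI[of _ "insert i T"] conjI)
        show "\<forall>b\<in>insert i T. \<forall>j. i < j \<and> j < b \<and> j \<notin> insert i T \<longrightarrow>
            j - 1 \<in> insert i T \<and> j + 1 \<in> insert i T \<and> kink w j"
        proof (intro ballI allI impI)
          fix b j assume b: "b \<in> insert i T" and j: "i < j \<and> j < b \<and> j \<notin> insert i T"
          show "j - 1 \<in> insert i T \<and> j + 1 \<in> insert i T \<and> kink w j"
          proof (cases "j = i + 1")
            case True
            then show ?thesis using k T(1) by auto
          next
            case False
            moreover from j T(1) have "j \<noteq> i + 2" by auto
            ultimately have "i + 2 < j" using j by linarith
            moreover have "b \<in> T" using b j by auto
            ultimately show ?thesis using T(3) j False by auto
          qed
        qed
        show "\<forall>j>i. kink w j \<longrightarrow> kink_form (alt_vec (insert i T)) j \<noteq> 0 \<longrightarrow> kink_form c j \<noteq> 0"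
        proof (intro allI impI)
          fix j assume j: "i < j" "kink w j" "kink_form (alt_vec (insert i T)) j \<noteq> 0"
          consider "j = i + 1" | "j = i + 2" | "i + 2 < j" using j(1) by linarith
          then show "kink_form c j \<noteq> 0"
          proof cases
            case 1
            then show ?thesis using j(3) i1 T(1) by (subst (asm) kink_form_alt_vec_eq_0_iff) auto
          next
            case 2
            \<comment> \<open>The form at \<open>i + 2\<close> reaches back to the skipped position
              \<open>i + 1\<close>, which is outside the range of the induction hypothesis; two
              adjacent kinks cannot occur.\<close>
            then show ?thesis using not_kink_Suc[OF w k(1)] j(2) by simp
          next
            case 3
            then have "kink_form (alt_vec T) j \<noteq> 0"
              using j by (subst kink_form_alt_vec_eq_0_iff, simp,
                          subst (asm) kink_form_alt_vec_eq_0_iff) auto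
            then show ?thesis using T(7) 3 j by auto
          qed
        qed
        show "\<forall>j\<ge>i. j < ?n \<longrightarrow> (j \<in> insert i T) \<noteq> (j + 1 \<in> insert i T) \<longrightarrow> c j \<noteq> c (j + 1)"
        proof (intro allI impI)
          fix j assume j: "i \<le> j" "j < ?n" "(j \<in> insert i T) \<noteq> (j + 1 \<in> insert i T)"
          consider "j = i" | "j = i + 1" | "i + 2 \<le> j" using j(1) by linarith
          then show "c j \<noteq> c (j + 1)"
          proof cases
            case 2
            then show ?thesis using c less.prems by simp
          qed (use neq T(5) j in auto)
        qed
        show "\<forall>j. j \<in> insert i T \<and> j + 1 \<in> insert i T \<longrightarrow> c j = c (j + 1)"
        proof (intro allI impI)
          fix j assume "j \<in> insert i T \<and> j + 1 \<in> insert i T"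
          then have "j \<in> T \<and> j + 1 \<in> T" using i1 T(2) by fastforce
          then show "c j = c (j + 1)" using T(6) by blast
        qed
      qed (use T(2,4) less.prems in auto)
    qed
  qed
qed

text \<open>The greedy set is started at the first nonzero position \<open>a\<close> of
  \<open>c\<close>. To the left of \<open>a\<close> both \<open>c\<close> and
  \<open>alt_vec T\<close> are zero, which controls the forms that
  \<open>greedy_connected_set\<close> leaves open, those at positions up to
  \<open>a\<close>.\<close>

lemma exists_alt_vec_below:
  assumes w: "w \<in> snake_words_V" and c: "i \<le> length w" "c i \<noteq> 0"
  shows "\<exists>S\<in>connected_sets w. forms_vanish_mono w c (alt_vec S)"
proof -
  let ?n = "length w"
  define a where "a = (LEAST j. c j \<noteq> 0)"
  have a: "a \<le> ?n" "c a \<noteq> 0"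
    using c Least_le[of "\<lambda>j. c j \<noteq> 0" i] LeastI[of "\<lambda>j. c j \<noteq> 0" i] by (auto simp: a_def)
  have below: "c j = 0" if "j < a" for j
    using that not_less_Least[of j "\<lambda>j. c j \<noteq> 0"] by (auto simp: a_def)
  obtain T where T: "a \<in> T" "T \<subseteq> {a..?n}"
    "\<forall>b\<in>T. \<forall>j. a < j \<and> j < b \<and> j \<notin> T \<longrightarrow> j - 1 \<in> T \<and> j + 1 \<in> T \<and> kink w j"
    "\<forall>j\<in>T. c j \<noteq> 0"
    "\<forall>j\<ge>a. j < ?n \<longrightarrow> (j \<in> T) \<noteq> (j + 1 \<in> T) \<longrightarrow> c j \<noteq> c (j + 1)"
    "\<forall>j. j \<in> T \<and> j + 1 \<in> T \<longrightarrow> c j = c (j + 1)"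
    "\<forall>j>a. kink w j \<longrightarrow> kink_form (alt_vec T) j \<noteq> 0 \<longrightarrow> kink_form c j \<noteq> 0"
    using greedy_connected_set[OF w a(1), of c, OF a(2)] by blast
  have ge: "a \<le> j" if "j \<in> T" for j using T(2) that by auto
  have "gap_connected w T"
    unfolding gap_connected_def
  proof (intro ballI allI impI)
    fix x b i assume x: "x \<in> T" "b \<in> T" "x < i \<and> i < b \<and> i \<notin> T"
    have "a < i" using ge[OF x(1)] x(3) by simp
    then show "i - 1 \<in> T \<and> i + 1 \<in> T \<and> kink w i" using T(3) x by blast
  qed
  then have conn: "T \<in> connected_sets w" using T(1,2) by (auto simp: connected_sets_def)
  have diff: "alt_vec T i = alt_vec T (i + 1)" if "i < ?n" "c i = c (i + 1)" for i
  proof (cases "a \<le> i")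
    case True
    then show ?thesis using T(5) that alt_vec_eq_Suc_iff[of T i] by auto
  next
    case False
    then have "i + 1 \<noteq> a" using that(2) a(2) below[of i] by auto
    then have "i \<notin> T" "i + 1 \<notin> T" using False ge by fastforce+
    then show ?thesis by (simp add: alt_vec_def)
  qed
  have kf: "kink_form (alt_vec T) j = 0" if j: "kink w j" "kink_form c j = 0" for j
  proof (rule ccontr)
    assume nz: "kink_form (alt_vec T) j \<noteq> 0"
    have pos: "0 < j" using j(1) by (rule kink_imp_pos)
    consider "a < j" | "j = a" | "j + 1 = a" | "j + 1 < a" by linarith
    then show False
    proof cases
      case 1
      then show ?thesis using T(7) j nz by blast
    next
      case 2
      have "a - 1 \<notin> T" using ge[of "a - 1"] pos 2 by auto
      \<comment> \<open>With \<open>a + 1\<close> in \<open>T\<close> the number of members would be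
        even and the form zero. Leaving out \<open>a + 1\<close> means
        \<open>c a \<noteq> c (a + 1)\<close>, whereas \<open>c (a - 1) = 0\<close> turns the
        vanishing form into equality of the two.\<close>
      then have "a + 1 \<notin> T"
        using nz T(1) pos unfolding 2 by (subst (asm) kink_form_alt_vec_eq_0_iff) auto
      moreover have "a < ?n" using kink_imp_less[OF j(1)] 2 by simp
      ultimately have "c a \<noteq> c (a + 1)" using T(1,5) by auto
      then show ?thesis using j(2) 2 pos below[of "a - 1"] by (simp add: kink_form_def)
    next
      case 3
      then have "c (j - 1) = 0" "c j = 0" by (intro below; linarith)+
      then show ?thesis using j(2) a(2) 3 by (simp add: kink_form_def)
    next
      case 4
      then have "j - 1 \<notin> T" "j \<notin> T" "j + 1 \<notin> T" using ge by fastforce+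
      then show ?thesis using nz by (simp add: kink_form_def alt_vec_def)
    qed
  qed
  have "forms_vanish_mono w c (alt_vec T)"
    unfolding forms_vanish_mono_def using diff kf T(4) by auto
  then show ?thesis using conn by blast
qed

lemma alt_vec_multiple_imp_eq:
  assumes "S \<in> connected_sets w" "T \<in> connected_sets w"
    and "\<And>i. i \<le> length w \<Longrightarrow> alt_vec S i = a * alt_vec T i"
  shows "S = T"
proof -
  have sub: "S \<subseteq> {..length w}" "T \<subseteq> {..length w}" "S \<noteq> {}"
    using assms(1,2) by (auto simp: connected_sets_def)
  then obtain i where "i \<in> S" by blast
  then have "a \<noteq> 0" using assms(3)[of i] sub by (auto simp: alt_vec_def)
  have "i \<in> S \<longleftrightarrow> i \<in> T" if "i \<le> length w" for i
    using assms(3)[OF that] \<open>a \<noteq> 0\<close> by (metis alt_vec_eq_0_iff mult_eq_0_iff)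
  then show ?thesis using sub by blast
qed

section \<open>Connected induced subgraphs of the word graph\<close>

lemma verts_word_graph [simp]: "verts (word_graph w) = {..length w}"
  by (auto simp: word_graph_def)

lemma arcs_word_graph [simp]: "arcs (word_graph w) = word_edges w \<union> (word_edges w)\<inverse>"
  by (simp add: word_graph_def)

lemma tail_word_graph [simp]: "tail (word_graph w) = fst"
  and head_word_graph [simp]: "head (word_graph w) = snd"
  by (simp_all add: word_graph_def)

lemma word_edges_iff:
  "(u, v) \<in> word_edges w \<longleftrightarrow>
    v \<le> length w \<and> (v = u + 1 \<or> v = u + 2 \<and> kink w (u + 1))"
  by (auto simp: word_edges_def kink_def letter_at_def)

lemma wf_word_graph: "wf_digraph (word_graph w)"
  by unfold_locales (auto simp: word_edges_iff)

text \<open>Compatibility of a subgraph fixes also its \<open>tail\<close> and \<open>head\<close>,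
  so even as a record an induced subgraph is determined by its vertex set.\<close>

lemma induced_word_subgraph_iff:
  "induced_subgraph H (word_graph w) \<and> verts H \<noteq> {} \<longleftrightarrow>
    (\<exists>S. S \<subseteq> {..length w} \<and> S \<noteq> {} \<and> H = word_graph w \<restriction> S)"
proof
  assume H: "induced_subgraph H (word_graph w) \<and> verts H \<noteq> {}"
  then have "verts H \<subseteq> {..length w}" by (auto simp: induced_subgraph_def subgraph_def)
  moreover have "H = word_graph w \<restriction> verts H"
    using H by (auto simp: induced_subgraph_def subgraph_def compatible_def induce_subgraph_def
        intro!: pre_digraph.equality)
  ultimately show "\<exists>S. S \<subseteq> {..length w} \<and> S \<noteq> {} \<and> H = word_graph w \<restriction> S" using H by blast
next
  assume "\<exists>S. S \<subseteq> {..length w} \<and> S \<noteq> {} \<and> H = word_graph w \<restriction> S"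
  then show "induced_subgraph H (word_graph w) \<and> verts H \<noteq> {}"
    using wf_digraph.induced_induce[OF wf_word_graph] by fastforce
qed

text \<open>A missing position is a barrier for walks unless an edge jumps over it, and such an edge
  needs both neighbours in \<open>S\<close> and a kink. Conversely, if every gap can be jumped, one
  can climb from the smaller of two members to the larger.\<close>

lemma connected_induce_iff:
  assumes S: "S \<subseteq> {..length w}" "S \<noteq> {}"
  shows "Digraph_Component.connected (word_graph w \<restriction> S) \<longleftrightarrow> gap_connected w S"
proof -
  let ?H = "mk_symmetric (word_graph w \<restriction> S)"
  have wfH: "wf_digraph (word_graph w \<restriction> S)"
    by (rule wf_digraph.wellformed_induce_subgraph[OF wf_word_graph])
  interpret pair_wf_digraph ?H
    by (rule wf_digraph.wellformed_mk_symmetric[OF wfH])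
  have arcs: "(u, v) \<in> parcs ?H \<longleftrightarrow>
      u \<in> S \<and> v \<in> S \<and> ((u, v) \<in> word_edges w \<or> (v, u) \<in> word_edges w)" for u v
    by (auto simp: parcs_mk_symmetric induce_subgraph_def)
  have conn: "Digraph_Component.connected (word_graph w \<restriction> S) \<longleftrightarrow>
      (\<forall>u\<in>S. \<forall>v\<in>S. u \<rightarrow>\<^sup>*\<^bsub>?H\<^esub> v)"
    using S by (simp add: connected_def strongly_connected_def)
  show ?thesis
  proof
    assume "Digraph_Component.connected (word_graph w \<restriction> S)"
    then have reach: "u \<rightarrow>\<^sup>*\<^bsub>?H\<^esub> v" if "u \<in> S" "v \<in> S" for u v
      using conn that by blast
    show "gap_connected w S"
      unfolding gap_connected_def
    proof (intro ballI allI impI, rule ccontr)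
      fix a b i assume ab: "a \<in> S" "b \<in> S" and i: "a < i \<and> i < b \<and> i \<notin> S"
        and no: "\<not> (i - 1 \<in> S \<and> i + 1 \<in> S \<and> kink w i)"
      have "v < i" if "a \<rightarrow>\<^sup>*\<^bsub>?H\<^esub> v" for v
        using that
      proof (induction rule: reachable_induct)
        case (step u v)
        have "(u, v) \<in> parcs ?H" using step.hyps by simp
        then have uv: "u \<in> S" "v \<in> S" "(u, v) \<in> word_edges w \<or> (v, u) \<in> word_edges w"
          using arcs by auto
        show ?case
        proof (rule ccontr)
          assume "\<not> v < i"
          with i uv(2) have "i < v" by (metis linorder_neqE_nat)
          with uv(3) step.IH have "v = u + 2" "kink w (u + 1)" "u + 1 = i"
            by (auto simp: word_edges_iff)
          then show False using no uv by auto
        qed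
      qed (use i in auto)
      then show False using reach[OF ab] i by fastforce
    qed
  next
    assume gc: "gap_connected w S"
    have sym: "v \<rightarrow>\<^sup>*\<^bsub>?H\<^esub> u" if "u \<rightarrow>\<^sup>*\<^bsub>?H\<^esub> v" for u v
      using that by (rule symmetric_reachable[OF symmetric_mk_symmetric])
    have up: "a \<rightarrow>\<^sup>*\<^bsub>?H\<^esub> b" if "a \<in> S" "b \<in> S" "a \<le> b" for a b
      using that
    proof (induction "b - a" arbitrary: a rule: less_induct)
      case less
      have bn: "b \<le> length w" using less.prems S by auto
      show ?case
      proof (cases "a = b")
        case True
        then show ?thesis using less.prems by simp
      next
        case False
        then have ab: "a < b" using less.prems by simp
        \<comment> \<open>The next vertex of the climb is \<open>a + 1\<close> or, if that is
          missing, \<open>a + 2\<close>; in the second case \<open>a + 1\<close> is a gap below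
          \<open>b\<close>, so \<open>gap_connected\<close> supplies the edge and keeps
          \<open>a + 2 \<le> b\<close>.\<close>
        obtain c where c: "c \<in> S" "a < c" "c \<le> b" "(a, c) \<in> word_edges w"
        proof (cases "a + 1 \<in> S")
          case True
          then show ?thesis using that[of "a + 1"] ab bn by (auto simp: word_edges_iff)
        next
          case nin: False
          then have "a + 1 < b" using ab less.prems by (metis Suc_eq_plus1 Suc_lessI)
          then have "a + 2 \<in> S" "kink w (a + 1)"
            using gc nin less.prems unfolding gap_connected_def by fastforce+
          then show ?thesis using that[of "a + 2"] \<open>a + 1 < b\<close> bn by (auto simp: word_edges_iff)
        qed
        then have "a \<rightarrow>\<^sup>*\<^bsub>?H\<^esub> c" using less.prems arcs by (intro reachable_adjI) simp
        also have "c \<rightarrow>\<^sup>*\<^bsub>?H\<^esub> b" using less.hyps[of c] less.prems c by simp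
        finally show ?thesis .
      qed
    qed
    show "Digraph_Component.connected (word_graph w \<restriction> S)"
      unfolding conn using up sym by (meson nat_le_linear)
  qed
qed

lemma bij_betw_verts_connected_induced_subgraphs:
  "bij_betw verts (connected_induced_subgraphs (word_graph w)) (connected_sets w)"
proof -
  have "H \<in> connected_induced_subgraphs (word_graph w) \<longleftrightarrow>
      (\<exists>S. S \<subseteq> {..length w} \<and> S \<noteq> {} \<and> H = word_graph w \<restriction> S) \<and>
      Digraph_Component.connected H" for H
    unfolding induced_word_subgraph_iff[symmetric] by (auto simp: connected_induced_subgraphs_def)
  then have "H \<in> connected_induced_subgraphs (word_graph w) \<longleftrightarrow>
      (\<exists>S\<in>connected_sets w. H = word_graph w \<restriction> S)" for H
    unfolding connected_sets_def by (metis (mono_tags, lifting) connected_induce_iff mem_Collect_eq)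
  then have "connected_induced_subgraphs (word_graph w) = (\<lambda>S. word_graph w \<restriction> S) ` connected_sets w"
    by blast
  moreover have "bij_betw verts ((\<lambda>S. word_graph w \<restriction> S) ` connected_sets w) (connected_sets w)"
    by (rule bij_betw_byWitness[where f' = "\<lambda>S. word_graph w \<restriction> S"]) auto
  ultimately show ?thesis by simp
qed

section \<open>The snake lattice and its irreducible elements\<close>

lemma nat_cases_mod2 [case_names zero one even odd]:
  obtains "x = 0" | "x = 1" | i where "x = 2 * i + 2" | i where "x = 2 * i + (3::nat)"
proof -
  consider "x = 0" | "x = 1" | "x \<ge> 2" "even x" | "x \<ge> 2" "odd x" by linarith
  then show ?thesis
  proof cases
    case 3
    then show ?thesis using that(3)[of "x div 2 - 1"] by auto
  next
    case 4
    then show ?thesis using that(4)[of "x div 2 - 1"] by (auto elim!: oddE)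
  qed (use that in blast)+
qed

text \<open>
  The square of the letter \<open>w\<^sub>i\<close> has bottom \<open>2 i + 3\<close>, sides \<open>2 i + 1\<close> and \<open>2 i + 2\<close>, and top
  \<open>square_top w i\<close>.
\<close>
definition square_top :: "snake_word \<Rightarrow> nat \<Rightarrow> nat" where
  "square_top w i =
     (if i = 0 then 0 else if i = 1 then (if w ! 0 = L then 1 else 2)
      else if w ! (i - 2) \<noteq> w ! (i - 1) then 2 * i - 1 else 2 * i)"

lemma square_top_0 [simp]: "square_top w 0 = 0"
  by (simp add: square_top_def)

lemma square_top_le: "square_top w i \<le> 2 * i"
  by (auto simp: square_top_def)

lemma square_top_Suc_cases: "square_top w (Suc i) = 2 * i + 1 \<or> square_top w (Suc i) = 2 * i + 2"
  by (auto simp: square_top_def)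

text \<open>With top \<open>0\<close> for the square of the empty letter, the initial four-element
  poset follows the pattern of all later squares, apart from the pair \<open>(1, 0)\<close>.\<close>

lemma mem_snake_covers_iff:
  "(x, y) \<in> snake_covers w n \<longleftrightarrow>
     x = 1 \<and> y = 0 \<or>
     (\<exists>i\<le>n. x = 2 * i + 3 \<and> (y = 2 * i + 1 \<or> y = 2 * i + 2) \<or> x = 2 * i + 2 \<and> y = square_top w i)"
proof (induction n)
  case 0
  then show ?case by auto
next
  case (Suc n)
  have letters: "(a, b) \<in> {(R, L), (L, R)} \<longleftrightarrow> a \<noteq> b"
    "(a, b) \<in> {(L, L), (R, R)} \<longleftrightarrow> a = b" for a b :: letter
    by (cases a; cases b; simp)+
  have not_L: "a \<noteq> L \<longleftrightarrow> a = R" for a :: letter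
    by (cases a) simp_all
  have odd_top: "(Suc n = 1 \<and> letter_at w (Suc n) = L \<or>
      2 \<le> Suc n \<and> letter_at w (Suc n - 1) \<noteq> letter_at w (Suc n)) \<longleftrightarrow>
      square_top w (Suc n) = 2 * Suc n - 1"
    by (cases n) (simp_all add: square_top_def letter_at_def)
  have even_top: "(Suc n = 1 \<and> letter_at w (Suc n) = R \<or>
      2 \<le> Suc n \<and> letter_at w (Suc n - 1) = letter_at w (Suc n)) \<longleftrightarrow>
      square_top w (Suc n) = 2 * Suc n"
    by (cases n) (simp_all add: square_top_def letter_at_def not_L)
  have "(x, y) \<in> snake_covers w (Suc n) \<longleftrightarrow> (x, y) \<in> snake_covers w n \<or>
      x = 2 * Suc n + 3 \<and> (y = 2 * Suc n + 1 \<or> y = 2 * Suc n + 2) \<or>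
      x = 2 * Suc n + 2 \<and> y = square_top w (Suc n)"
    unfolding snake_covers.simps Let_def letters odd_top even_top
    using square_top_Suc_cases[of w n] by auto
  moreover have ex_Suc: "(\<exists>i\<le>Suc n. Q i) \<longleftrightarrow> (\<exists>i\<le>n. Q i) \<or> Q (Suc n)" for Q
    using le_Suc_eq by auto
  ultimately show ?case unfolding Suc.IH by (simp only: ex_Suc disj_assoc)
qed

definition snake_le :: "snake_word \<Rightarrow> nat \<Rightarrow> nat \<Rightarrow> bool" where
  "snake_le w x y \<longleftrightarrow> (x, y) \<in> snake_poset w"

lemma snake_covers_less:
  assumes "(x, y) \<in> snake_covers w n"
  shows "y < x" "x \<le> 2 * n + 3"
  using assms by (auto simp: mem_snake_covers_iff le_less_trans[OF square_top_le])

lemma snake_le_iff_rtrancl: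
  "snake_le w x y \<longleftrightarrow> x \<le> 2 * length w + 3 \<and> (x, y) \<in> (snake_covers w (length w))\<^sup>*"
proof -
  have "x \<le> 2 * length w + 3" if "(x, y) \<in> (snake_covers w (length w))\<^sup>+"
    using tranclD[OF that] snake_covers_less(2) by blast
  then show ?thesis
    by (auto simp: snake_le_def snake_poset_def rtrancl_eq_or_trancl)
qed

lemma snake_le_refl: "x \<le> 2 * length w + 3 \<Longrightarrow> snake_le w x x"
  by (simp add: snake_le_iff_rtrancl)

lemma snake_le_trans: "snake_le w x y \<Longrightarrow> snake_le w y z \<Longrightarrow> snake_le w x z"
  by (auto simp: snake_le_iff_rtrancl)

text \<open>Every cover relation goes up to a smaller number, so the numbering is a linear extension
  of the dual order. This yields antisymmetry and serves as the measure of the inductions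
  below.\<close>

lemma snake_le_imp_ge: "snake_le w x y \<Longrightarrow> y \<le> x"
proof -
  have "y \<le> x" if "(x, y) \<in> (snake_covers w (length w))\<^sup>*"
    using that by induction (use snake_covers_less(1) in force)+
  then show "snake_le w x y \<Longrightarrow> y \<le> x" by (simp add: snake_le_iff_rtrancl)
qed

lemma snake_le_bound: "snake_le w x y \<Longrightarrow> x \<le> 2 * length w + 3"
  by (simp add: snake_le_iff_rtrancl)

lemma snake_le_antisym: "snake_le w x y \<Longrightarrow> snake_le w y x \<Longrightarrow> x = y"
  using snake_le_imp_ge by (meson le_antisym)

lemma snake_le_unfold:
  "snake_le w x y \<longleftrightarrow>
     x \<le> 2 * length w + 3 \<and> (x = y \<or> (\<exists>z. (x, z) \<in> snake_covers w (length w) \<and> snake_le w z y))"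
proof -
  have "z \<le> 2 * length w + 3" if "(x, z) \<in> snake_covers w (length w)" for z
    using snake_covers_less[OF that] by linarith
  moreover have "(x, y) \<in> (snake_covers w (length w))\<^sup>* \<longleftrightarrow>
      x = y \<or> (\<exists>z. (x, z) \<in> snake_covers w (length w) \<and> (z, y) \<in> (snake_covers w (length w))\<^sup>*)"
    by (metis converse_rtranclE converse_rtrancl_into_rtrancl rtrancl.rtrancl_refl)
  ultimately show ?thesis unfolding snake_le_iff_rtrancl by blast
qed

lemma snake_le_0: "snake_le w 0 y \<longleftrightarrow> y = 0"
  using snake_le_imp_ge snake_le_refl by fastforce

lemma snake_le_1: "snake_le w 1 y \<longleftrightarrow> y = 1 \<or> y = 0"
  by (subst snake_le_unfold) (auto simp: mem_snake_covers_iff snake_le_0)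

lemma snake_le_even:
  assumes "i \<le> length w"
  shows "snake_le w (2 * i + 2) y \<longleftrightarrow> y = 2 * i + 2 \<or> snake_le w (square_top w i) y"
proof -
  have "(2 * i + 2, z) \<in> snake_covers w (length w) \<longleftrightarrow> z = square_top w i" for z
    using assms by (auto simp: mem_snake_covers_iff) presburger+
  then show ?thesis using assms by (subst snake_le_unfold) auto
qed

lemma snake_le_odd:
  assumes "i \<le> length w"
  shows "snake_le w (2 * i + 3) y \<longleftrightarrow>
    y = 2 * i + 3 \<or> snake_le w (2 * i + 1) y \<or> snake_le w (2 * i + 2) y"
proof -
  have "(2 * i + 3, z) \<in> snake_covers w (length w) \<longleftrightarrow> z = 2 * i + 1 \<or> z = 2 * i + 2" for z
    using assms by (auto simp: mem_snake_covers_iff) presburger+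
  then show ?thesis using assms by (subst snake_le_unfold) auto
qed

text \<open>Each new bottom \<open>2 i + 3\<close> lies below both \<open>2 i + 1\<close> and
  \<open>2 i + 2\<close>, hence by induction below every element with a smaller number.\<close>

lemma snake_le_odd_ge:
  "i \<le> length w + 1 \<Longrightarrow> y \<le> 2 * i + 1 \<Longrightarrow> snake_le w (2 * i + 1) y"
proof (induction i)
  case 0
  then show ?case using snake_le_1[of w y] by auto
next
  case (Suc i)
  have "y \<le> 2 * i + 1 \<or> y = 2 * i + 2 \<or> y = 2 * i + 3" using Suc.prems by auto
  moreover have "snake_le w (2 * i + 2) (2 * i + 2)" using Suc.prems by (intro snake_le_refl) auto
  ultimately show ?case using snake_le_odd[of i w y] Suc by (auto simp: numeral_3_eq_3)
qed

lemma snake_le_odd_square_top: "i \<le> length w \<Longrightarrow> snake_le w (2 * i + 1) (square_top w i)"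
  using square_top_le[of w i] by (intro snake_le_odd_ge) auto

lemma snake_le_to_0: "x \<le> 2 * length w + 3 \<Longrightarrow> snake_le w x 0"
proof (induction x rule: less_induct)
  case (less x)
  show ?case
  proof (cases x rule: nat_cases_mod2)
    case (even i)
    then show ?thesis
      using snake_le_even[of i w 0] less square_top_le[of w i] by auto
  next
    case (odd i)
    then show ?thesis using snake_le_odd_ge[of "i + 1" w 0] less.prems by (simp add: numeral_3_eq_3)
  qed (use snake_le_0 snake_le_1[of w 0] in auto)
qed

lemma not_snake_le_even_odd: "i \<le> length w \<Longrightarrow> \<not> snake_le w (2 * i + 2) (2 * i + 1)"
  using snake_le_even[of i w "2 * i + 1"] snake_le_imp_ge[of w "square_top w i" "2 * i + 1"]
    square_top_le[of w i] by auto

text \<open>This makes \<open>2 i + 3\<close> the meet of the two sides of its square. An even lower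
  bound with a larger number passes both relations on to its only upper cover, and an odd one lies
  below all smaller numbers.\<close>

lemma snake_le_meet:
  assumes "i \<le> length w" "snake_le w a (2 * i + 1)" "snake_le w a (2 * i + 2)"
  shows "snake_le w a (2 * i + 3)"
  using assms(2,3)
proof (induction a rule: less_induct)
  case (less a)
  have ge: "2 * i + 2 \<le> a" using snake_le_imp_ge less.prems by blast
  have n: "a \<le> 2 * length w + 3" using snake_le_bound less.prems by blast
  have ne: "a \<noteq> 2 * i + 2" using not_snake_le_even_odd[OF assms(1)] less.prems by auto
  show ?case
  proof (cases a rule: nat_cases_mod2)
    case (even j)
    then have j: "j \<le> length w" "i < j" using n ge ne by auto
    then have "snake_le w (square_top w j) (2 * i + 1)" "snake_le w (square_top w j) (2 * i + 2)"
      using less.prems snake_le_even[of j w] even by auto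
    then have "snake_le w (square_top w j) (2 * i + 3)"
      using less.IH[of "square_top w j"] square_top_le[of w j] even by auto
    then show ?thesis using snake_le_even[OF j(1)] even by auto
  next
    case (odd j)
    then show ?thesis using snake_le_odd_ge[of "j + 1" w "2 * i + 3"] n ge
      by (simp add: numeral_3_eq_3)
  qed (use ge in auto)
qed

definition irreducible_nats :: "snake_word \<Rightarrow> nat set" where
  "irreducible_nats w = {0, 1} \<union> {2 * i + 2 |i. i \<le> length w}"

text \<open>Every element is a meet of irreducible ones: by \<open>snake_le_meet\<close> an odd
  element \<open>2 i + 3\<close> is the meet of two elements with smaller numbers.\<close>

lemma snake_le_if_irreducibles:
  assumes "x \<le> 2 * length w + 3" "y \<le> 2 * length w + 3"
    and "\<And>m. m \<in> irreducible_nats w \<Longrightarrow> snake_le w y m \<Longrightarrow> snake_le w x m"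
  shows "snake_le w x y"
  using assms(2,3)
proof (induction y rule: less_induct)
  case (less y)
  show ?case
  proof (cases y rule: nat_cases_mod2)
    case (odd i)
    then have i: "i \<le> length w" using less.prems by auto
    have "snake_le w x (2 * i + 1)" "snake_le w x (2 * i + 2)"
      using less odd snake_le_odd[OF i] by auto
    then show ?thesis using snake_le_meet[OF i] odd by auto
  next
    case (even i)
    then have "y \<in> irreducible_nats w" using less.prems(1) by (auto simp: irreducible_nats_def)
    then show ?thesis using less.prems snake_le_refl by blast
  qed (use less.prems snake_le_refl in \<open>auto simp: irreducible_nats_def\<close>)
qed

text \<open>For \<open>k > 0\<close> the top is \<open>2 k - 1\<close> or \<open>2 k\<close>, so the
  only other number in range is \<open>2 k\<close>, and it is not below
  \<open>2 k - 1\<close>.\<close>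

lemma below_square_top:
  assumes "k \<le> length w" "x \<le> 2 * k + 1" "snake_le w x (square_top w k)"
  shows "x = square_top w k \<or> x = 2 * k + 1"
proof (cases k)
  case 0
  then show ?thesis using assms(2) by auto
next
  case (Suc i)
  have ge: "square_top w k \<le> x" using assms(3) snake_le_imp_ge by blast
  have "\<not> snake_le w (2 * i + 2) (2 * i + 1)"
    using not_snake_le_even_odd assms(1) Suc by simp
  then show ?thesis
    using square_top_Suc_cases[of w i] ge assms(2,3) Suc by (cases "x = 2 * i + 2") auto
qed

text \<open>This is the surjectivity part of Birkhoff's theorem, by adding one square at a time. If
  \<open>2 k + 2\<close> is in \<open>U\<close>, the rest of \<open>U\<close> is generated by some
  \<open>x\<close> below the top of square \<open>k\<close>; by \<open>below_square_top\<close> this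
  is the top itself or the side \<open>2 k + 1\<close>, and \<open>U\<close> is then generated by
  the other side \<open>2 k + 2\<close> or by the bottom \<open>2 k + 3\<close>.\<close>

lemma filter_principal:
  assumes "k \<le> length w + 1" "U \<subseteq> {0, 1} \<union> {2 * i + 2 |i. i < k}" "U \<noteq> {}"
    and up: "\<And>a b. a \<in> U \<Longrightarrow> b \<in> irreducible_nats w \<Longrightarrow> snake_le w a b \<Longrightarrow> b \<in> U"
  shows "\<exists>x\<le>2 * k + 1. \<forall>m\<in>irreducible_nats w. m \<in> U \<longleftrightarrow> snake_le w x m"
  using assms
proof (induction k arbitrary: U)
  case 0
  then have "U \<subseteq> {0, 1}" by auto
  moreover have "0 \<in> U" if "1 \<in> U"
    using that 0(4)[of 1 0] snake_le_1[of w 0] by (auto simp: irreducible_nats_def)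
  ultimately consider "U = {0}" | "U = {0, 1}" using 0(3) by auto
  then show ?case
  proof cases
    case 1
    then show ?thesis by (intro exI[of _ 0]) (auto simp: snake_le_0)
  next
    case 2
    then show ?thesis using snake_le_1 by (intro exI[of _ 1]) auto
  qed
next
  case (Suc k)
  have k: "k \<le> length w" using Suc.prems by simp
  show ?case
  proof (cases "2 * k + 2 \<in> U")
    case False
    then have "U \<subseteq> {0, 1} \<union> {2 * i + 2 |i. i < k}"
      using Suc.prems(2) by (auto simp: less_Suc_eq)
    then obtain x where "x \<le> 2 * k + 1" "\<forall>m\<in>irreducible_nats w. m \<in> U \<longleftrightarrow> snake_le w x m"
      using Suc.IH[of U] Suc.prems by auto
    then show ?thesis by (intro exI[of _ x]) simp
  next
    case True
    let ?t = "square_top w k"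
    define V where "V = U - {2 * k + 2}"
    have V: "V \<subseteq> {0, 1} \<union> {2 * i + 2 |i. i < k}"
      using Suc.prems(2) by (auto simp: V_def less_Suc_eq)
    have "0 \<in> U"
      using Suc.prems(4)[OF True, of 0] snake_le_to_0[of "2 * k + 2" w] k
      by (auto simp: irreducible_nats_def)
    then have "V \<noteq> {}" by (auto simp: V_def)
    moreover have "b \<in> V" if "a \<in> V" "b \<in> irreducible_nats w" "snake_le w a b" for a b
    proof -
      have "b \<le> a" using that snake_le_imp_ge by blast
      moreover have "a < 2 * k + 2" using V that(1) by auto
      ultimately show ?thesis using Suc.prems(4)[of a b] that by (auto simp: V_def)
    qed
    ultimately have "\<exists>x\<le>2 * k + 1. \<forall>m\<in>irreducible_nats w. m \<in> V \<longleftrightarrow> snake_le w x m"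
      using V k by (intro Suc.IH) simp_all
    then obtain x where x: "x \<le> 2 * k + 1"
      "\<And>m. m \<in> irreducible_nats w \<Longrightarrow> m \<in> V \<longleftrightarrow> snake_le w x m"
      by blast
    have "snake_le w x ?t"
    proof (rule snake_le_if_irreducibles)
      fix m assume m: "m \<in> irreducible_nats w" "snake_le w ?t m"
      then have "m \<in> U"
        using Suc.prems(4)[OF True] snake_le_even[OF k] by blast
      moreover have "m \<noteq> 2 * k + 2"
        using snake_le_imp_ge[OF m(2)] square_top_le[of w k] by auto
      ultimately show "snake_le w x m" using x(2)[OF m(1)] by (simp add: V_def)
    qed (use x(1) k square_top_le[of w k] in auto)
    then consider "x = ?t" | "x = 2 * k + 1" using below_square_top k x(1) by blast
    then show ?thesis
    proof cases
      case 1
      show ?thesis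
      proof (intro exI[of _ "2 * k + 2"] conjI ballI)
        fix m assume "m \<in> irreducible_nats w"
        then show "m \<in> U \<longleftrightarrow> snake_le w (2 * k + 2) m"
          using x(2)[of m] snake_le_even[OF k, of m] True 1 by (auto simp: V_def)
      qed auto
    next
      case 2
      show ?thesis
      proof (intro exI[of _ "2 * k + 3"] conjI ballI)
        fix m assume m: "m \<in> irreducible_nats w"
        have "m \<noteq> 2 * k + 3" using m by (auto simp: irreducible_nats_def) presburger+
        moreover have "snake_le w (2 * k + 1) m" if "snake_le w ?t m"
          using that snake_le_trans snake_le_odd_square_top[OF k] by blast
        ultimately show "m \<in> U \<longleftrightarrow> snake_le w (2 * k + 3) m"
          using x(2)[OF m] snake_le_even[OF k, of m] snake_le_odd[OF k, of m] True 2
          by (auto simp: V_def)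
      qed auto
    qed
  qed
qed

text \<open>This is inclusion-exclusion: an irreducible element is above the bottom iff it is above
  one of the sides, and above the top iff it is above both.\<close>

lemma square_identity:
  assumes i: "i \<le> length w" and m: "m \<in> irreducible_nats w"
  shows "(of_bool (snake_le w (square_top w i) m) + of_bool (snake_le w (2 * i + 3) m) :: real) =
    of_bool (snake_le w (2 * i + 1) m) + of_bool (snake_le w (2 * i + 2) m)"
proof -
  have "m \<noteq> 2 * i + 3" using m by (auto simp: irreducible_nats_def) presburger+
  moreover have "snake_le w (2 * i + 1) m" if "snake_le w (square_top w i) m"
    using that snake_le_trans snake_le_odd_square_top[OF i] by blast
  moreover have "\<not> snake_le w (2 * i + 1) (2 * i + 2)"
    using snake_le_imp_ge by fastforce
  ultimately show ?thesis using snake_le_even[OF i, of m] snake_le_odd[OF i, of m] by auto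
qed

section \<open>Vertices of the order polytope as lattice elements\<close>

abbreviation lattice_elements :: "snake_word \<Rightarrow> nat bounded set" where
  "lattice_elements w \<equiv> insert Bot (insert Top (Elem ` {..2 * length w + 3}))"

definition lattice_irreducibles :: "snake_word \<Rightarrow> nat bounded set" where
  "lattice_irreducibles w = insert Bot (Elem ` irreducible_nats w)"

lemma irreducible_nats_subset: "irreducible_nats w \<subseteq> {..2 * length w + 3}"
  by (auto simp: irreducible_nats_def)

lemma lattice_irreducibles_subset: "lattice_irreducibles w \<subseteq> lattice_elements w"
  using irreducible_nats_subset by (auto simp: lattice_irreducibles_def)

lemma Field_snake_poset: "Field (snake_poset w) = {..2 * length w + 3}"
proof -
  have "x \<le> 2 * length w + 3 \<and> y \<le> 2 * length w + 3" if "(x, y) \<in> snake_poset w" for x y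
    using that snake_le_bound[of w x y] snake_le_imp_ge[of w x y] by (auto simp: snake_le_def)
  moreover have "(x, x) \<in> snake_poset w" if "x \<le> 2 * length w + 3" for x
    using snake_le_refl[OF that] by (simp add: snake_le_def)
  ultimately show ?thesis by (auto simp: Field_def)
qed

lemma snake_lattice_iff:
  "(X, Y) \<in> snake_lattice w \<longleftrightarrow>
     X = Bot \<and> Y \<in> lattice_elements w \<or> Y = Top \<and> X \<in> lattice_elements w \<or>
     (\<exists>x y. X = Elem x \<and> Y = Elem y \<and> snake_le w x y)"
  by (auto simp: snake_lattice_def adjoin_bounds_def Let_def Field_snake_poset snake_le_def)

lemma snake_lattice_simps [simp]:
  "(Bot, Y) \<in> snake_lattice w \<longleftrightarrow> Y \<in> lattice_elements w"
  "(X, Top) \<in> snake_lattice w \<longleftrightarrow> X \<in> lattice_elements w"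
  "(X, Bot) \<in> snake_lattice w \<longleftrightarrow> X = Bot"
  "(Top, Y) \<in> snake_lattice w \<longleftrightarrow> Y = Top"
  "(Elem x, Elem y) \<in> snake_lattice w \<longleftrightarrow> snake_le w x y"
  by (auto simp: snake_lattice_iff)

lemma snake_lattice_imp_elements:
  assumes "(X, Y) \<in> snake_lattice w"
  shows "X \<in> lattice_elements w \<and> Y \<in> lattice_elements w"
proof (cases X; cases Y)
  fix x y assume "X = Elem x" "Y = Elem y"
  then show ?thesis using assms snake_le_bound[of w x y] snake_le_imp_ge[of w x y] by auto
qed (use assms in auto)

lemma snake_lattice_refl: "X \<in> lattice_elements w \<Longrightarrow> (X, X) \<in> snake_lattice w"
  using snake_le_refl by (auto simp: snake_lattice_iff)

lemma snake_lattice_trans: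
  assumes "(X, Y) \<in> snake_lattice w" "(Y, Z) \<in> snake_lattice w"
  shows "(X, Z) \<in> snake_lattice w"
proof (cases X; cases Y; cases Z)
  fix x y z assume "X = Elem x" "Y = Elem y" "Z = Elem z"
  then show ?thesis using assms snake_le_trans[of w x y z] by simp
qed (use assms snake_lattice_imp_elements[OF assms(1)] snake_lattice_imp_elements[OF assms(2)] in simp_all)

lemma snake_lattice_antisym:
  assumes "(X, Y) \<in> snake_lattice w" "(Y, X) \<in> snake_lattice w"
  shows "X = Y"
proof (cases X; cases Y)
  fix x y assume "X = Elem x" "Y = Elem y"
  then show ?thesis using assms snake_le_antisym[of w x y] by simp
qed (use assms in simp_all)

lemma Field_snake_lattice: "Field (snake_lattice w) = lattice_elements w"
  using snake_lattice_imp_elements snake_lattice_refl by (intro set_eqI) (metis Field_iff)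

lemma unique_cover:
  assumes "antisym r" "(x, u) \<in> r" "x \<noteq> u" "\<And>y. (x, y) \<in> r \<Longrightarrow> y \<noteq> x \<Longrightarrow> (u, y) \<in> r"
  shows "\<exists>!y. covered_by r x y"
proof (rule ex1I[of _ u])
  show "covered_by r x u"
    using assms unfolding covered_by_def by (metis antisymD)
  fix y assume "covered_by r x y"
  then show "y = u" using assms unfolding covered_by_def by metis
qed

text \<open>The only candidate strictly between is \<open>2 i + 2\<close> below
  \<open>2 i + 1\<close>, and these two sides are not so related. Having two covers excludes the odd
  elements from \<open>3\<close> on as meet-irreducibles.\<close>

lemma covered_by_odd:
  assumes i: "i \<le> length w" and u: "u = 2 * i + 1 \<or> u = 2 * i + 2"
  shows "covered_by (snake_lattice w) (Elem (2 * i + 3)) (Elem u)"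
  unfolding covered_by_def
proof (intro conjI notI)
  show "(Elem (2 * i + 3), Elem u) \<in> snake_lattice w"
    using snake_le_odd[OF i, of u] snake_le_refl[of u w] u i by auto
  assume "\<exists>z. (Elem (2 * i + 3), z) \<in> snake_lattice w \<and> (z, Elem u) \<in> snake_lattice w \<and>
    z \<noteq> Elem (2 * i + 3) \<and> z \<noteq> Elem u"
  then obtain Z where Z: "(Elem (2 * i + 3), Z) \<in> snake_lattice w" "(Z, Elem u) \<in> snake_lattice w"
    "Z \<noteq> Elem (2 * i + 3)" "Z \<noteq> Elem u" by blast
  then obtain z where z: "Z = Elem z" by (cases Z) auto
  have "snake_le w z u" "z \<noteq> u" "z \<noteq> 2 * i + 3" "z \<le> 2 * i + 3"
    using Z z snake_le_imp_ge by auto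
  then have "u = 2 * i + 1" "z = 2 * i + 2"
    using snake_le_imp_ge[of w z u] u by auto
  then show False using not_snake_le_even_odd[OF i] \<open>snake_le w z u\<close> by simp
qed (use u in auto)

lemma meet_irreducibles_snake_lattice:
  "meet_irreducibles (snake_lattice w) = lattice_irreducibles w"
proof -
  let ?r = "snake_lattice w"
  have anti: "antisym ?r" using snake_lattice_antisym by (auto intro: antisymI)
  \<comment> \<open>The only cover of \<open>Bot\<close> is the minimum of the snake poset, which is
    the bottom of the last square.\<close>
  have Bot: "\<exists>!y. covered_by ?r Bot y"
  proof (rule unique_cover[OF anti, of _ "Elem (2 * length w + 3)"])
    fix Y assume "(Bot, Y) \<in> ?r" "Y \<noteq> Bot"
    then show "(Elem (2 * length w + 3), Y) \<in> ?r"
      using snake_le_odd_ge[of "length w + 1" w] by (auto simp: numeral_3_eq_3)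
  qed auto
  have zero: "\<exists>!y. covered_by ?r (Elem 0) y"
  proof (rule unique_cover[OF anti, of _ Top])
    fix Y assume "(Elem 0, Y) \<in> ?r" "Y \<noteq> Elem 0"
    then show "(Top, Y) \<in> ?r" by (cases Y) (auto simp: snake_le_0)
  qed auto
  have one: "\<exists>!y. covered_by ?r (Elem 1) y"
  proof (rule unique_cover[OF anti, of _ "Elem 0"])
    show "(Elem 1, Elem 0) \<in> ?r" using snake_le_1[of w 0] by simp
    fix Y assume "(Elem 1, Y) \<in> ?r" "Y \<noteq> Elem 1"
    then show "(Elem 0, Y) \<in> ?r" using snake_le_1[of w] by (cases Y) (auto simp: snake_le_0)
  qed auto
  have even: "\<exists>!y. covered_by ?r (Elem (2 * i + 2)) y" if i: "i \<le> length w" for i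
  proof (rule unique_cover[OF anti, of _ "Elem (square_top w i)"])
    have "square_top w i \<le> 2 * i" by (rule square_top_le)
    then have t: "square_top w i \<le> 2 * length w + 3" "square_top w i \<noteq> 2 * i + 2" using i by auto
    then show "(Elem (2 * i + 2), Elem (square_top w i)) \<in> ?r" "Elem (2 * i + 2) \<noteq> Elem (square_top w i)"
      using snake_le_even[OF i] snake_le_refl by auto
    fix Y assume "(Elem (2 * i + 2), Y) \<in> ?r" "Y \<noteq> Elem (2 * i + 2)"
    then show "(Elem (square_top w i), Y) \<in> ?r" using snake_le_even[OF i] t by (cases Y) auto
  qed
  have odd: "\<not> (\<exists>!y. covered_by ?r (Elem (2 * i + 3)) y)" if i: "i \<le> length w" for i
  proof
    assume "\<exists>!y. covered_by ?r (Elem (2 * i + 3)) y"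
    then have "Elem (2 * i + 1) = Elem (2 * i + 2)"
      using covered_by_odd[OF i, of "2 * i + 1"] covered_by_odd[OF i, of "2 * i + 2"] by blast
    then show False by simp
  qed
  have "X \<in> meet_irreducibles ?r \<longleftrightarrow> X \<in> lattice_irreducibles w" for X
  proof (cases "X \<in> lattice_elements w")
    case False
    then show ?thesis
      using lattice_irreducibles_subset by (auto simp: meet_irreducibles_def Field_snake_lattice)
  next
    case True
    then consider "X = Bot" | "X = Top" | x where "X = Elem x" "x \<le> 2 * length w + 3" by auto
    then show ?thesis
    proof cases
      case (3 x)
      have "(\<exists>!y. covered_by ?r (Elem x) y) \<longleftrightarrow> x \<in> irreducible_nats w"
      proof (cases x rule: nat_cases_mod2)
        case (even i)
        then show ?thesis using \<open>\<And>i. i \<le> length w \<Longrightarrow> \<exists>!y. covered_by ?r (Elem (2 * i + 2)) y\<close>[of i] 3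
          by (auto simp: irreducible_nats_def)
      next
        case (odd i)
        then have "x \<notin> irreducible_nats w" by (auto simp: irreducible_nats_def) presburger+
        then show ?thesis using \<open>\<And>i. i \<le> length w \<Longrightarrow> \<not> (\<exists>!y. covered_by ?r (Elem (2 * i + 3)) y)\<close>[of i] 3 odd
          by auto
      qed (use \<open>\<exists>!y. covered_by ?r (Elem 0) y\<close> \<open>\<exists>!y. covered_by ?r (Elem 1) y\<close> in
          \<open>simp_all add: irreducible_nats_def\<close>)
      then show ?thesis using True 3 by (auto simp: meet_irreducibles_def Field_snake_lattice lattice_irreducibles_def)
    qed (use Bot in \<open>auto simp: meet_irreducibles_def Field_snake_lattice lattice_irreducibles_def\<close>)
  qed
  then show ?thesis by blast
qed

lemma snake_Q_iff:
  "(X, Y) \<in> snake_Q w \<longleftrightarrow>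
    X \<in> lattice_irreducibles w \<and> Y \<in> lattice_irreducibles w \<and> (X, Y) \<in> snake_lattice w"
  by (auto simp: snake_Q_def meet_irreducibles_snake_lattice)

lemma Field_snake_Q: "Field (snake_Q w) = lattice_irreducibles w"
  using snake_lattice_refl lattice_irreducibles_subset
  by (intro set_eqI) (metis Field_iff snake_Q_iff subsetD)

text \<open>This is Birkhoff's correspondence in coordinates: \<open>Top\<close> gives the empty
  filter and \<open>Bot\<close> the full one.\<close>

definition filter_vec :: "snake_word \<Rightarrow> nat bounded \<Rightarrow> nat bounded \<Rightarrow> real" where
  "filter_vec w X = (\<lambda>M. of_bool (M \<in> lattice_irreducibles w \<and> (X, M) \<in> snake_lattice w))"

text \<open>The coordinate at \<open>Bot\<close> singles out \<open>Bot\<close>, and the one at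
  \<open>Elem 0\<close>, the maximum of the snake poset, singles out \<open>Top\<close>. All others
  are separated because they are meets of irreducible elements.\<close>

lemma filter_vec_eq_iff:
  assumes "X \<in> lattice_elements w" "Y \<in> lattice_elements w"
    and eq: "\<And>M. M \<in> lattice_irreducibles w \<Longrightarrow> (X, M) \<in> snake_lattice w \<longleftrightarrow> (Y, M) \<in> snake_lattice w"
  shows "X = Y"
proof -
  have Bot: "X = Bot \<longleftrightarrow> Y = Bot" using eq[of Bot] by (simp add: lattice_irreducibles_def)
  have le0: "(Z, Elem 0) \<in> snake_lattice w \<longleftrightarrow> Z \<noteq> Top" if "Z \<in> lattice_elements w" for Z
    using that snake_le_to_0 by auto
  have Top: "X = Top \<longleftrightarrow> Y = Top"
    using eq[of "Elem 0"] le0 assms(1,2) by (auto simp: lattice_irreducibles_def irreducible_nats_def)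
  show ?thesis
  proof (cases "X = Bot \<or> X = Top")
    case False
    then obtain x y where xy: "X = Elem x" "x \<le> 2 * length w + 3" "Y = Elem y" "y \<le> 2 * length w + 3"
      using assms(1,2) Bot Top by auto
    have iff: "snake_le w x m \<longleftrightarrow> snake_le w y m" if "m \<in> irreducible_nats w" for m
      using eq[of "Elem m"] that xy by (simp add: lattice_irreducibles_def)
    have "snake_le w x y" "snake_le w y x"
      by (rule snake_le_if_irreducibles; use xy iff in simp)+
    then show ?thesis using xy snake_le_antisym by blast
  qed (use Bot Top in auto)
qed

lemma inj_on_filter_vec: "inj_on (filter_vec w) (lattice_elements w)"
proof (rule inj_onI)
  fix X Y assume XY: "X \<in> lattice_elements w" "Y \<in> lattice_elements w" "filter_vec w X = filter_vec w Y"
  have "(X, M) \<in> snake_lattice w \<longleftrightarrow> (Y, M) \<in> snake_lattice w" if "M \<in> lattice_irreducibles w" for M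
    using fun_cong[OF XY(3), of M] that
      by (simp add: filter_vec_def of_bool_eq_iff del: snake_lattice_simps)
  then show "X = Y" using filter_vec_eq_iff XY(1,2) by blast
qed

lemma polytope_vertices_snake_Q:
  "polytope_vertices (order_polytope (snake_Q w)) = filter_vec w ` lattice_elements w"
  unfolding polytope_vertices_order_polytope Field_snake_Q
proof (intro equalityI subsetI; (elim CollectE conjE)?)
  fix v assume "v \<in> filter_vec w ` lattice_elements w"
  then obtain X where X: "v = filter_vec w X" by blast
  have "v i \<le> v j" if "(i, j) \<in> snake_Q w" for i j
    using that snake_lattice_trans[of X i w j]
    by (simp add: X filter_vec_def snake_Q_iff del: snake_lattice_simps)
  moreover have "v i = 0 \<or> v i = 1" "i \<notin> lattice_irreducibles w \<Longrightarrow> v i = 0" for i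
    by (simp_all add: X filter_vec_def of_bool_def)
  ultimately show "v \<in> {x. (\<forall>i. i \<notin> lattice_irreducibles w \<longrightarrow> x i = 0) \<and> (\<forall>i. x i \<in> {0, 1}) \<and>
      (\<forall>(i, j)\<in>snake_Q w. x i \<le> x j)}" by auto
next
  fix v :: "nat bounded \<Rightarrow> real"
  assume "\<forall>i. i \<notin> lattice_irreducibles w \<longrightarrow> v i = 0" "\<forall>i. v i \<in> {0, 1}"
    "\<forall>(i, j)\<in>snake_Q w. v i \<le> v j"
  then have v: "\<And>i. i \<notin> lattice_irreducibles w \<Longrightarrow> v i = 0" "\<And>i. v i = 0 \<or> v i = 1"
    "\<And>i j. (i, j) \<in> snake_Q w \<Longrightarrow> v i \<le> v j" by auto
  have up: "v j = 1" if "v i = 1" "i \<in> lattice_irreducibles w" "j \<in> lattice_irreducibles w"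
      "(i, j) \<in> snake_lattice w" for i j
    using v(2)[of j] v(3)[of i j] that by (auto simp: snake_Q_iff)
  define U where "U = {m \<in> irreducible_nats w. v (Elem m) = 1}"
  have "\<exists>X\<in>lattice_elements w. \<forall>M\<in>lattice_irreducibles w. v M = 1 \<longleftrightarrow> (X, M) \<in> snake_lattice w"
  proof (cases "v Bot = 1")
    case True
    have "v M = 1" if "M \<in> lattice_irreducibles w" for M
      using up[OF True _ that] that lattice_irreducibles_subset
      by (auto simp: lattice_irreducibles_def)
    then show ?thesis
      using lattice_irreducibles_subset by (intro bexI[of _ Bot]) auto
  next
    case nBot: False
    show ?thesis
    proof (cases "U = {}")
      case True
      then show ?thesis
        using nBot by (intro bexI[of _ Top]) (auto simp: U_def lattice_irreducibles_def)
    next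
      case False
      have "U \<subseteq> {0, 1} \<union> {2 * i + 2 |i. i < length w + 1}"
        by (auto simp: U_def irreducible_nats_def)
      moreover have "b \<in> U" if "a \<in> U" "b \<in> irreducible_nats w" "snake_le w a b" for a b
        using up[of "Elem a" "Elem b"] that by (auto simp: U_def lattice_irreducibles_def)
      ultimately obtain x where x: "x \<le> 2 * (length w + 1) + 1"
        "\<forall>m\<in>irreducible_nats w. m \<in> U \<longleftrightarrow> snake_le w x m"
        using filter_principal[of "length w + 1" w U] False by auto
      show ?thesis
        using x nBot by (intro bexI[of _ "Elem x"]) (auto simp: U_def lattice_irreducibles_def)
    qed
  qed
  then obtain X where X: "X \<in> lattice_elements w"
    "\<And>M. M \<in> lattice_irreducibles w \<Longrightarrow> v M = 1 \<longleftrightarrow> (X, M) \<in> snake_lattice w" by blast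
  have "v M = filter_vec w X M" for M
    using X(2)[of M] v(1,2)[of M] by (auto simp: filter_vec_def)
  then show "v \<in> filter_vec w ` lattice_elements w" using X(1) by auto
qed

section \<open>Affine relations between the vertices\<close>

definition square_vec :: "snake_word \<Rightarrow> nat \<Rightarrow> nat bounded \<Rightarrow> real" where
  "square_vec w i X = of_bool (X = Elem (square_top w i)) + of_bool (X = Elem (2 * i + 3))
     - of_bool (X = Elem (2 * i + 1)) - of_bool (X = Elem (2 * i + 2))"

lemma sum_square_vec:
  assumes i: "i \<le> length w"
  shows "(\<Sum>X\<in>lattice_elements w. square_vec w i X * g X) =
    g (Elem (square_top w i)) + g (Elem (2 * i + 3)) - g (Elem (2 * i + 1)) - g (Elem (2 * i + 2))"
proof -
  have single: "(\<Sum>X\<in>lattice_elements w. of_bool (X = Elem x) * g X) = g (Elem x)"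
    if "x \<le> 2 * length w + 3" for x
    using that by (subst sum.mono_neutral_right[of _ "{Elem x}"]) auto
  have "square_top w i \<le> 2 * length w + 3" "2 * i + 3 \<le> 2 * length w + 3"
    "2 * i + 1 \<le> 2 * length w + 3" "2 * i + 2 \<le> 2 * length w + 3"
    using square_top_le[of w i] i by simp_all
  note singles = this[THEN single]
  show ?thesis
    by (simp only: square_vec_def distrib_right left_diff_distrib sum.distrib sum_subtractf singles)
qed

lemma sum_fun_apply: "(\<Sum>x\<in>I. f x) m = (\<Sum>x\<in>I. f x m)"
  for f :: "'i \<Rightarrow> 'a \<Rightarrow> 'b::comm_monoid_add"
  by (induction I rule: infinite_finite_induct) auto

lemma affine_relation_filter_vec_iff:
  "affine_relation (lattice_elements w) (filter_vec w) l \<longleftrightarrow>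
    (\<Sum>X\<in>lattice_elements w. l X) = 0 \<and>
    (\<forall>M\<in>lattice_irreducibles w. (\<Sum>X\<in>lattice_elements w. l X * of_bool ((X, M) \<in> snake_lattice w)) = 0)"
proof -
  have "(\<Sum>X\<in>lattice_elements w. l X *\<^sub>R filter_vec w X) M =
      (if M \<in> lattice_irreducibles w
       then \<Sum>X\<in>lattice_elements w. l X * of_bool ((X, M) \<in> snake_lattice w) else 0)" for M
    unfolding sum_fun_apply by (simp add: scaleR_fun_def filter_vec_def del: snake_lattice_simps)
  moreover have "(\<forall>M. (if M \<in> A then f M else 0) = 0) \<longleftrightarrow> (\<forall>M\<in>A. f M = (0 :: real))"
    for A and f :: "nat bounded \<Rightarrow> real" by auto
  ultimately show ?thesis unfolding affine_relation_def fun_eq_iff zero_fun_apply by (simp only:)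
qed

lemma affine_relation_square_vec:
  assumes i: "i \<le> length w"
  shows "affine_relation (lattice_elements w) (filter_vec w) (square_vec w i)"
  unfolding affine_relation_filter_vec_iff
proof (intro conjI ballI)
  show "(\<Sum>X\<in>lattice_elements w. square_vec w i X) = 0"
    using sum_square_vec[OF i, of "\<lambda>_. 1"] by simp
  fix M assume M: "M \<in> lattice_irreducibles w"
  then consider "M = Bot" | m where "M = Elem m" "m \<in> irreducible_nats w"
    by (auto simp: lattice_irreducibles_def)
  then show "(\<Sum>X\<in>lattice_elements w. square_vec w i X * of_bool ((X, M) \<in> snake_lattice w)) = 0"
    unfolding sum_square_vec[OF i]
  proof cases
    case (2 m)
    then show "of_bool ((Elem (square_top w i), M) \<in> snake_lattice w) +
        of_bool ((Elem (2 * i + 3), M) \<in> snake_lattice w) -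
        of_bool ((Elem (2 * i + 1), M) \<in> snake_lattice w) -
        of_bool ((Elem (2 * i + 2), M) \<in> snake_lattice w) = (0 :: real)"
      using square_identity[OF i, of m] by simp
  qed simp
qed

lemma affine_relation_add_scale:
  assumes "affine_relation I p l" "affine_relation I p l'"
  shows "affine_relation I p (\<lambda>x. l x + a * l' x)"
  using assms
  by (simp add: affine_relation_def sum.distrib scaleR_left_distrib
      flip: sum_distrib_left scaleR_scaleR scaleR_sum_right)

definition square_comb :: "snake_word \<Rightarrow> (nat \<Rightarrow> real) \<Rightarrow> nat bounded \<Rightarrow> real" where
  "square_comb w c X = (\<Sum>i\<le>length w. c i * square_vec w i X)"

lemma affine_relation_square_comb:
  "affine_relation (lattice_elements w) (filter_vec w) (square_comb w c)"
proof -
  have "affine_relation (lattice_elements w) (filter_vec w) (\<lambda>X. \<Sum>i\<in>J. c i * square_vec w i X)"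
    if "finite J" "J \<subseteq> {..length w}" for J
    using that
  proof (induction J rule: finite_induct)
    case empty
    then show ?case by (simp add: affine_relation_def)
  next
    case (insert i J)
    then have "affine_relation (lattice_elements w) (filter_vec w)
        (\<lambda>X. (\<Sum>i\<in>J. c i * square_vec w i X) + c i * square_vec w i X)"
      by (intro affine_relation_add_scale affine_relation_square_vec) auto
    then show ?case using insert.hyps by (simp add: add.commute)
  qed
  then show ?thesis unfolding square_comb_def by blast
qed

text \<open>
  At an irreducible element only larger numbers and \<open>Bot\<close> lie below it, so the coordinate
  equations are triangular.
\<close>
lemma affine_relation_eq_0:
  assumes rel: "affine_relation (lattice_elements w) (filter_vec w) l"
    and odd: "\<And>i. i \<le> length w \<Longrightarrow> l (Elem (2 * i + 3)) = 0"
    and X: "X \<in> lattice_elements w"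
  shows "l X = 0"
proof -
  let ?E = "lattice_elements w"
  have total: "(\<Sum>X\<in>?E. l X) = 0"
    and coord: "\<And>M. M \<in> lattice_irreducibles w \<Longrightarrow>
      (\<Sum>X\<in>?E. l X * of_bool ((X, M) \<in> snake_lattice w)) = 0"
    using rel unfolding affine_relation_filter_vec_iff by auto
  have pivot: "l M = 0" if M: "M \<in> lattice_irreducibles w"
    and below: "\<And>X. X \<in> ?E \<Longrightarrow> (X, M) \<in> snake_lattice w \<Longrightarrow> X \<noteq> M \<Longrightarrow> l X = 0" for M
  proof -
    have ME: "M \<in> ?E" using M lattice_irreducibles_subset by blast
    have "(\<Sum>X\<in>?E. l X * of_bool ((X, M) \<in> snake_lattice w)) =
        (\<Sum>X\<in>{M}. l X * of_bool ((X, M) \<in> snake_lattice w))"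
      using ME below by (intro sum.mono_neutral_right) auto
    then show ?thesis using coord[OF M] snake_lattice_refl[OF ME] by simp
  qed
  have Bot: "l Bot = 0" by (rule pivot) (auto simp: lattice_irreducibles_def)
  have Elem: "x \<le> 2 * length w + 3 \<Longrightarrow> l (Elem x) = 0" for x
  proof (induction "2 * length w + 3 - x" arbitrary: x rule: less_induct)
    case less
    show ?case
    proof (cases "x \<in> irreducible_nats w")
      case True
      show ?thesis
      proof (rule pivot)
        fix X assume X: "X \<in> ?E" "(X, Elem x) \<in> snake_lattice w" "X \<noteq> Elem x"
        then consider "X = Bot" | y where "X = Elem y" "snake_le w y x" "y \<noteq> x"
          by (cases X) auto
        then show "l X = 0"
        proof cases
          case (2 y)
          then have "x < y" "y \<le> 2 * length w + 3"
            using snake_le_imp_ge[of w y x] snake_le_bound[of w y x] by auto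
          then show ?thesis using less.hyps[of y] 2 by auto
        qed (use Bot in simp)
      qed (use True in \<open>simp add: lattice_irreducibles_def\<close>)
    next
      case False
      show ?thesis
      proof (cases x rule: nat_cases_mod2)
        case (odd i)
        then show ?thesis using assms(2)[of i] less.prems by simp
      qed (use False less.prems in \<open>auto simp: irreducible_nats_def\<close>)
    qed
  qed
  \<comment> \<open>\<open>Top\<close> lies below no irreducible element, so its coefficient is seen
    only by the condition that all coefficients sum to zero.\<close>
  have "(\<Sum>X\<in>?E. l X) = (\<Sum>X\<in>{Top}. l X)"
    using Bot Elem by (intro sum.mono_neutral_right) auto
  then have "l Top = 0" using total by simp
  then show ?thesis using X Bot Elem by auto
qed

text \<open>Subtracting a multiple of a square clears the coefficient at its bottom. Going from the
  last square to the first leaves a relation that vanishes at all bottoms, and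
  \<open>affine_relation_eq_0\<close> disposes of it.\<close>

lemma affine_relation_imp_square_comb:
  assumes rel: "affine_relation (lattice_elements w) (filter_vec w) l"
  shows "\<exists>c. \<forall>X\<in>lattice_elements w. l X = square_comb w c X"
proof -
  have "\<exists>c. \<forall>X\<in>lattice_elements w. l X = square_comb w c X"
    if "k \<le> length w + 1" "affine_relation (lattice_elements w) (filter_vec w) l"
      "\<And>i. k \<le> i \<Longrightarrow> i \<le> length w \<Longrightarrow> l (Elem (2 * i + 3)) = 0" for k l
    using that
  proof (induction k arbitrary: l)
    case 0
    have "l X = square_comb w (\<lambda>_. 0) X" if "X \<in> lattice_elements w" for X
      using affine_relation_eq_0[OF 0(2) 0(3) that] by (simp add: square_comb_def)
    then show ?case by blast
  next
    case (Suc k)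
    define a where "a = l (Elem (2 * k + 3))"
    have k: "k \<le> length w" using Suc.prems by simp
    have t: "square_top w k \<le> 2 * k" by (rule square_top_le)
    have "affine_relation (lattice_elements w) (filter_vec w) (\<lambda>X. l X + (- a) * square_vec w k X)"
      by (intro affine_relation_add_scale affine_relation_square_vec Suc.prems k)
    moreover have "l (Elem (2 * i + 3)) + (- a) * square_vec w k (Elem (2 * i + 3)) = 0"
      if "k \<le> i" "i \<le> length w" for i
    proof (cases "i = k")
      case True
      have "square_vec w k (Elem (2 * k + 3)) = 1" using t by (simp add: square_vec_def)
      then show ?thesis using True by (simp add: a_def)
    next
      case False
      \<comment> \<open>Square \<open>k\<close> involves no number above \<open>2 k + 3\<close>, so
        the bottoms cleared earlier stay cleared.\<close>
      then have "square_vec w k (Elem (2 * i + 3)) = 0"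
        using t that by (simp add: square_vec_def)
      then show ?thesis using Suc.prems(3)[of i] False that by simp
    qed
    ultimately have "\<exists>c. \<forall>X\<in>lattice_elements w. l X + (- a) * square_vec w k X = square_comb w c X"
      using k by (intro Suc.IH) simp_all
    then obtain c where c:
      "\<And>X. X \<in> lattice_elements w \<Longrightarrow> l X + (- a) * square_vec w k X = square_comb w c X"
      by blast
    have add: "square_comb w (\<lambda>i. c i + (if i = k then a else 0)) X =
        square_comb w c X + a * square_vec w k X" for X
      using k by (simp add: square_comb_def distrib_right sum.distrib if_distrib[of "\<lambda>x. x * _"]
          cong: if_cong)
    have "l X = square_comb w (\<lambda>i. c i + (if i = k then a else 0)) X" if "X \<in> lattice_elements w" for X
      using c[OF that] unfolding add by linarith
    then show ?case by blast
  qed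
  from this[of "length w + 1" l] show ?thesis using rel by simp
qed

section \<open>Coordinates of a combination of squares\<close>

lemma square_comb_Bot [simp]: "square_comb w c Bot = 0"
  and square_comb_Top [simp]: "square_comb w c Top = 0"
  by (simp_all add: square_comb_def square_vec_def)

lemma sum_of_bool_single:
  fixes c :: "nat \<Rightarrow> real"
  assumes "\<And>i. P i \<Longrightarrow> i = k"
  shows "(\<Sum>i\<le>n. c i * of_bool (P i)) = (if k \<le> n \<and> P k then c k else 0)"
proof -
  have "(\<Sum>i\<le>n. c i * of_bool (P i)) = (\<Sum>i\<in>{..n} \<inter> {k}. c i * of_bool (P i))"
    using assms by (intro sum.mono_neutral_right) auto
  then show ?thesis by (cases "k \<le> n") auto
qed

text \<open>The top of square \<open>k + 1\<close> is \<open>2 k + 1\<close> or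
  \<open>2 k + 2\<close>, so its value determines the square: no element is the top of two
  squares.\<close>

lemma square_top_eq_iff_odd: "square_top w i = 2 * j + 1 \<longleftrightarrow> i = j + 1 \<and> square_top w (j + 1) = 2 * j + 1"
proof (cases i)
  case (Suc k)
  then show ?thesis using square_top_Suc_cases[of w k] by auto presburger+
qed auto

lemma square_top_eq_iff_even: "square_top w i = 2 * j + 2 \<longleftrightarrow> i = j + 1 \<and> square_top w (j + 1) = 2 * j + 2"
proof (cases i)
  case (Suc k)
  then show ?thesis using square_top_Suc_cases[of w k] by auto presburger+
qed auto

lemma square_comb_expand:
  "square_comb w c (Elem x) =
    (\<Sum>i\<le>length w. c i * of_bool (x = square_top w i)) + (\<Sum>i\<le>length w. c i * of_bool (x = 2 * i + 3))
    - (\<Sum>i\<le>length w. c i * of_bool (x = 2 * i + 1)) - (\<Sum>i\<le>length w. c i * of_bool (x = 2 * i + 2))"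
  unfolding square_comb_def square_vec_def bounded.inject
  by (simp only: right_diff_distrib distrib_left sum.distrib sum_subtractf)

lemma square_comb_0: "square_comb w c (Elem 0) = c 0"
proof -
  have "i = 0" if "0 = square_top w i" for i
    using square_top_Suc_cases[of w "i - 1"] that by (cases i) auto
  then have "(\<Sum>i\<le>length w. c i * of_bool (0 = square_top w i)) = c 0"
    by (subst sum_of_bool_single[of _ 0]) auto
  then show ?thesis unfolding square_comb_expand by simp
qed

lemma square_comb_odd:
  "square_comb w c (Elem (2 * j + 1)) =
    (if j + 1 \<le> length w \<and> square_top w (j + 1) = 2 * j + 1 then c (j + 1) else 0)
    + (if j = 0 \<or> j > length w + 1 then 0 else c (j - 1)) - (if j \<le> length w then c j else 0)"
proof -
  have "(\<Sum>i\<le>length w. c i * of_bool (2 * j + 1 = square_top w i)) =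
      (if j + 1 \<le> length w \<and> 2 * j + 1 = square_top w (j + 1) then c (j + 1) else 0)"
    using square_top_eq_iff_odd by (intro sum_of_bool_single) metis
  moreover have "(\<Sum>i\<le>length w. c i * of_bool (2 * j + 1 = 2 * i + 3)) =
      (if j = 0 \<or> j > length w + 1 then 0 else c (j - 1))"
    by (subst sum_of_bool_single[of _ "j - 1"]) auto
  moreover have "(\<Sum>i\<le>length w. c i * of_bool (2 * j + 1 = 2 * i + 1)) =
      (if j \<le> length w then c j else 0)"
    by (subst sum_of_bool_single[of _ j]) auto
  moreover have "2 * j + 1 \<noteq> 2 * i + 2" for i
    by presburger
  then have "(\<Sum>i\<le>length w. c i * of_bool (2 * j + 1 = 2 * i + 2)) = 0"
    by (intro sum.neutral) simp
  ultimately show ?thesis unfolding square_comb_expand by (simp only: eq_commute[of "2 * j + 1"] diff_0_right)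
qed

lemma square_comb_even:
  assumes "j \<le> length w"
  shows "square_comb w c (Elem (2 * j + 2)) =
    (if j + 1 \<le> length w \<and> square_top w (j + 1) = 2 * j + 2 then c (j + 1) else 0) - c j"
proof -
  have "(\<Sum>i\<le>length w. c i * of_bool (2 * j + 2 = square_top w i)) =
      (if j + 1 \<le> length w \<and> 2 * j + 2 = square_top w (j + 1) then c (j + 1) else 0)"
    using square_top_eq_iff_even by (intro sum_of_bool_single) metis
  moreover have "(\<Sum>i\<le>length w. c i * of_bool (2 * j + 2 = 2 * i + 2)) =
      (if j \<le> length w \<and> 2 * j + 2 = 2 * j + 2 then c j else 0)"
    by (intro sum_of_bool_single) simp
  moreover have "of_bool (2 * j + 2 = 2 * i + 1) = (0 :: real)" "of_bool (2 * j + 2 = 2 * i + 3) = (0 :: real)" for i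
    by simp_all presburger+
  ultimately show ?thesis unfolding square_comb_expand using assms by auto
qed

lemma kink_iff_square_top:
  assumes "1 \<le> j" "j < length w"
  shows "kink w j \<longleftrightarrow> square_top w (j + 1) = 2 * j + 1"
    and "\<not> kink w j \<longleftrightarrow> square_top w (j + 1) = 2 * j + 2"
  using assms by (auto simp: kink_def square_top_def)

text \<open>Up to sign every coordinate is one of the forms, and every form occurs as a coordinate.
  The second claim is the delicate one, because at a kink \<open>i\<close> the element
  \<open>2 i + 2\<close> does not show the difference of \<open>c i\<close> and
  \<open>c (i + 1)\<close>.\<close>

lemma square_comb_vanish_iff:
  assumes w: "w \<in> snake_words_V"
  shows "(\<forall>X\<in>lattice_elements w. square_comb w c X = 0 \<longrightarrow> square_comb w c' X = 0) \<longleftrightarrow>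
    forms_vanish_mono w c c'" (is "?V \<longleftrightarrow> ?F")
proof
  let ?n = "length w"
  assume ?V
  then have V: "square_comb w c' (Elem x) = 0" if "square_comb w c (Elem x) = 0" "x \<le> 2 * ?n + 3" for x
    using that by auto
  have last: "square_comb w c (Elem (2 * ?n + 3)) = c ?n" for c
    using square_comb_odd[of w c "?n + 1"] by (simp add: numeral_3_eq_3)
  have diff: "c' i = c' (i + 1)" if i: "i < ?n" "c i = c (i + 1)" for i
  proof (cases "i = 0")
    case True
    \<comment> \<open>Exactly one of the elements \<open>1\<close> and \<open>2\<close> is the top
      of square \<open>1\<close>; its coordinate is \<open>c 1 - c 0\<close>, that of the other is
      \<open>- c 0\<close>.\<close>
    have at_1: "square_comb w c (Elem 1) = (if square_top w 1 = 1 then c 1 else 0) - c 0"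
      and at_2: "square_comb w c (Elem 2) = (if square_top w 1 = 2 then c 1 else 0) - c 0" for c
      using i square_comb_odd[of w c 0] square_comb_even[of 0 w c] by (auto simp: numeral_2_eq_2)
    have "square_top w 1 = 1 \<or> square_top w 1 = 2" using square_top_Suc_cases[of w 0] by auto
    then show ?thesis
      using V[of 1] V[of 2] i True unfolding at_1 at_2 by auto
  next
    case i0: False
    show ?thesis
    proof (cases "kink w i")
      case False
      then show ?thesis
        using V[of "2 * i + 2"] square_comb_even[of i w] kink_iff_square_top(2)[of i w] i i0 by auto
    next
      case True
      \<comment> \<open>Since \<open>i + 1\<close> is not a kink, \<open>2 i + 3\<close> is not the
        top of square \<open>i + 2\<close>, and its coordinate is the missing difference
        \<open>c i - c (i + 1)\<close>.\<close>
      have "\<not> kink w (i + 1)" using not_kink_Suc[OF w True] by simp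
      then have "\<not> (i + 2 \<le> ?n \<and> square_top w (i + 2) = 2 * i + 3)"
        using kink_iff_square_top(1)[of "i + 1" w] i by auto
      then show ?thesis
        using V[of "2 * (i + 1) + 1"] square_comb_odd[of w _ "i + 1"] i by auto
    qed
  qed
  have kink: "(c j = 0 \<longrightarrow> c' j = 0) \<and> (kink_form c j = 0 \<longrightarrow> kink_form c' j = 0)" if j: "kink w j" for j
  proof -
    have b: "1 \<le> j" "j < ?n" "square_top w (j + 1) = 2 * j + 1"
      using j kink_iff_square_top(1)[of j w] by (auto simp: kink_def)
    have "square_comb w c (Elem (2 * j + 2)) = - c j" "square_comb w c (Elem (2 * j + 1)) = kink_form c j" for c
      using square_comb_even[of j w c] square_comb_odd[of w c j] b by (auto simp: kink_form_def)
    then show ?thesis using V[of "2 * j + 2"] V[of "2 * j + 1"] b by auto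
  qed
  show ?F
    unfolding forms_vanish_mono_def
    using V[of 0] V[of "2 * ?n + 3"] diff kink by (auto simp: square_comb_0 last)
next
  let ?n = "length w"
  assume F: ?F
  have c0: "c' 0 = 0" if "c 0 = 0" using F that by (auto simp: forms_vanish_mono_def)
  have cn: "c' ?n = 0" if "c ?n = 0" using F that by (auto simp: forms_vanish_mono_def)
  have diff: "c' i = c' (i + 1)" if "i < ?n" "c i = c (i + 1)" for i
    using F that by (auto simp: forms_vanish_mono_def)
  have kink: "c j = 0 \<Longrightarrow> c' j = 0" "kink_form c j = 0 \<Longrightarrow> kink_form c' j = 0" if "kink w j" for j
    using F that by (auto simp: forms_vanish_mono_def)
  have at_even: "square_comb w c' (Elem (2 * j + 2)) = 0"
    if j: "j \<le> ?n" and z: "square_comb w c (Elem (2 * j + 2)) = 0" for j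
  proof -
    consider "j = ?n" | "j = 0" "j < ?n" | "kink w j" "j < ?n" | "0 < j" "j < ?n" "\<not> kink w j"
      using j by linarith
    then show ?thesis
    proof cases
      case 1
      then show ?thesis using z cn square_comb_even[OF j] by simp
    next
      case 2
      then show ?thesis using z c0 diff[of 0] square_comb_even[OF j] by (auto split: if_splits)
    next
      case 3
      then have "square_top w (j + 1) = 2 * j + 1"
        using kink_iff_square_top(1)[of j w] kink_imp_pos[of w j] by auto
      then show ?thesis using z kink(1)[of j] 3 square_comb_even[OF j] by auto
    next
      case 4
      then show ?thesis
        using z diff[of j] square_comb_even[OF j] kink_iff_square_top(2)[of j w] by auto
    qed
  qed
  have at_odd: "square_comb w c' (Elem (2 * j + 1)) = 0"
    if j: "j \<le> ?n + 1" and z: "square_comb w c (Elem (2 * j + 1)) = 0" for j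
  proof -
    consider "j = ?n + 1" | "j = 0" | "kink w j" "j \<le> ?n" | "0 < j" "j \<le> ?n" "\<not> kink w j"
      using j by linarith
    then show ?thesis
    proof cases
      case 1
      then show ?thesis using z cn square_comb_odd[of w _ j] by simp
    next
      case 2
      then show ?thesis
        using z c0 diff[of 0] square_comb_odd[of w _ 0] by (auto simp: Suc_le_eq split: if_splits)
    next
      case 3
      then have "square_top w (j + 1) = 2 * j + 1" "0 < j" "j < ?n"
        using kink_iff_square_top(1)[of j w] kink_imp_pos[of w j] kink_imp_less[of w j] by auto
      then show ?thesis
        using z kink(2)[of j] 3 square_comb_odd[of w _ j] by (auto simp: kink_form_def)
    next
      case 4
      then have "\<not> (j + 1 \<le> ?n \<and> square_top w (j + 1) = 2 * j + 1)"
        using kink_iff_square_top(1)[of j w] by auto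
      then show ?thesis
        using z diff[of "j - 1"] 4 square_comb_odd[of w _ j] by auto
    qed
  qed
  show ?V
  proof (intro ballI impI)
    fix X assume X: "X \<in> lattice_elements w" "square_comb w c X = 0"
    then consider "X = Bot \<or> X = Top" | x where "X = Elem x" "x \<le> 2 * ?n + 3" by auto
    then show "square_comb w c' X = 0"
    proof cases
      case (2 x)
      show ?thesis
      proof (cases x rule: nat_cases_mod2)
        case zero
        then show ?thesis using 2 X(2) c0 by (simp add: square_comb_0)
      next
        case one
        then show ?thesis using 2 X(2) at_odd[of 0] by simp
      next
        case (even i)
        then show ?thesis using 2 X(2) at_even[of i] by simp
      next
        case (odd i)
        then show ?thesis using 2 X(2) at_odd[of "i + 1"] by (simp add: numeral_3_eq_3)
      qed
    qed auto
  qed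
qed

lemma bij_betw_connected_sets_order_circuits:
  assumes w: "w \<in> snake_words_V"
  shows "bij_betw (\<lambda>S. filter_vec w ` {X \<in> lattice_elements w. square_comb w (alt_vec S) X \<noteq> 0})
    (connected_sets w) (order_circuits (snake_Q w))"
proof -
  define E where "E = lattice_elements w"
  note rel_imp_comb = affine_relation_imp_square_comb[of w, folded E_def]
  note vanish_iff = square_comb_vanish_iff[OF w, folded E_def]
  have mono: "forms_vanish_mono w c c'"
    if "\<And>X. X \<in> E \<Longrightarrow> square_comb w c X = 0 \<Longrightarrow> square_comb w c' X = 0" for c c'
    unfolding vanish_iff[symmetric] using that by simp
  have scale: "square_comb w c X = a * square_comb w c' X"
    if "\<And>i. i \<le> length w \<Longrightarrow> c i = a * c' i" for c c' a X
    using that by (simp add: square_comb_def sum_distrib_left mult.assoc)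
  \<comment> \<open>This is linear independence of the squares. Comparison with the zero
    coefficients, all of whose forms vanish, makes \<open>c\<close> zero at \<open>0\<close> and
    constant.\<close>
  have eq_0: "c i = 0" if zero: "\<And>X. X \<in> E \<Longrightarrow> square_comb w c X = 0" and i: "i \<le> length w" for c i
  proof -
    have "forms_vanish_mono w (\<lambda>_. 0) c" by (rule mono) (rule zero)
    then have "c 0 = 0" "\<And>i. i < length w \<Longrightarrow> c i = c (i + 1)" by (auto simp: forms_vanish_mono_def)
    with i show ?thesis by (induction i) auto
  qed
  show ?thesis
    unfolding order_circuits_def polytope_vertices_snake_Q E_def[symmetric]
  proof (rule bij_betw_circuits)
    show "finite E" by (simp add: E_def)
    show "inj_on (filter_vec w) E" unfolding E_def by (rule inj_on_filter_vec)
    show "affine_relation E (filter_vec w) (square_comb w (alt_vec S))" for S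
      unfolding E_def by (rule affine_relation_square_comb)
  next
    fix S assume S: "S \<in> connected_sets w"
    then obtain i where i: "i \<in> S" "i \<le> length w" by (auto simp: connected_sets_def)
    show "\<exists>X\<in>E. square_comb w (alt_vec S) X \<noteq> 0"
    proof (rule ccontr)
      assume "\<not> (\<exists>X\<in>E. square_comb w (alt_vec S) X \<noteq> 0)"
      then have zero: "square_comb w (alt_vec S) X = 0" if "X \<in> E" for X using that by blast
      have "alt_vec S i = 0" by (rule eq_0[OF _ i(2)]) (rule zero)
      then show False using i(1) by simp
    qed
  next
    fix S l assume S: "S \<in> connected_sets w" and l: "affine_relation E (filter_vec w) l"
      and zero: "\<forall>X\<in>E. square_comb w (alt_vec S) X = 0 \<longrightarrow> l X = 0"
    obtain c where c: "\<forall>X\<in>E. l X = square_comb w c X"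
      using rel_imp_comb[OF l] by blast
    have "forms_vanish_mono w (alt_vec S) c"
      by (rule mono) (use c zero in simp)
    then obtain a where "\<And>i. i \<le> length w \<Longrightarrow> c i = a * alt_vec S i"
      using multiple_of_alt_vec[OF S] by blast
    then have "square_comb w c X = a * square_comb w (alt_vec S) X" for X by (rule scale)
    then show "\<exists>a. \<forall>X\<in>E. l X = a * square_comb w (alt_vec S) X" using c by simp
  next
    fix l assume l: "affine_relation E (filter_vec w) l" and nz: "\<exists>X\<in>E. l X \<noteq> 0"
    obtain c where c: "\<forall>X\<in>E. l X = square_comb w c X"
      using rel_imp_comb[OF l] by blast
    have "\<exists>i\<le>length w. c i \<noteq> 0"
    proof (rule ccontr)
      assume "\<not> (\<exists>i\<le>length w. c i \<noteq> 0)"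
      then have "square_comb w c X = 0" for X by (simp add: square_comb_def)
      then show False using nz c by simp
    qed
    then obtain i where "i \<le> length w" "c i \<noteq> 0" by blast
    then obtain S where "S \<in> connected_sets w" "forms_vanish_mono w c (alt_vec S)"
      using exists_alt_vec_below[OF w, of i c] by blast
    then show "\<exists>S\<in>connected_sets w. \<forall>X\<in>E. l X = 0 \<longrightarrow> square_comb w (alt_vec S) X = 0"
      using vanish_iff[of c "alt_vec S"] c by (intro bexI[of _ S]) simp_all
  next
    fix S T a assume ST: "S \<in> connected_sets w" "T \<in> connected_sets w"
      and eq: "\<forall>X\<in>E. square_comb w (alt_vec S) X = a * square_comb w (alt_vec T) X"
    have diff: "square_comb w (\<lambda>i. alt_vec S i - a * alt_vec T i) X =
        square_comb w (alt_vec S) X - a * square_comb w (alt_vec T) X" for X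
      by (simp add: square_comb_def sum_distrib_left sum_subtractf left_diff_distrib mult.assoc)
    have "alt_vec S i - a * alt_vec T i = 0" if "i \<le> length w" for i
      by (rule eq_0[OF _ that, of "\<lambda>i. alt_vec S i - a * alt_vec T i"]) (use eq diff in simp)
    then show "S = T" by (intro alt_vec_multiple_imp_eq[OF ST, of a]) simp
  qed
qed

text \<open>Explicitly, the bijection sends a subgraph with vertex set \<open>S\<close> to the
  vertices of the polytope with nonzero coefficient in the combination of squares given by
  \<open>alt_vec S\<close>.\<close>

theorem theorem4p5:
  fixes w :: snake_word
  assumes "w \<in> snake_words_V"
  shows "\<exists>\<Gamma>. bij_betw \<Gamma> (connected_induced_subgraphs (word_graph w)) (order_circuits (snake_Q w))"
  by (rule exI, rule bij_betw_trans[OF bij_betw_verts_connected_induced_subgraphs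
        bij_betw_connected_sets_order_circuits[OF assms]])

end
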